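(* Let $n>k\ge 1$ be integers, $r=n-k$, and let $\alpha$ be an integer with $2\le \alpha\le r$. Let $q$ be a prime power with $$q>\binom{n-1}{k-1}-\binom{\lceil n/\alpha\rceil-1}{\lceil k/\alpha\rceil-1}.$$ Then there exists a choice of all the coefficients $\theta$ (taken in $\mathbb{F}_q\setminus\{0,1\}$) appearing in the construction of the set transformed code ST-RS$(n,k,\alpha)$ over $\mathbb{F}_q$ (described in the context) such that the resulting code is an MDS array code, i.e., the $k\alpha$ data symbols can be recovered from the $k\alpha$ symbols stored in any $k$ of the $n$ nodes.
   Context: **Base code.** Fix a systematic $(n,k)$ Reed–Solomon (MDS) code over $\mathbb{F}_q$: a data vector $\boldsymbol a=(a_1,\dots,a_k)$ is encoded as $(a_1,\dots,a_k,f_1(\boldsymbol a),\dots,f_r(\boldsymbol a))$ with linear parity functions $f_s$. Form an $\alpha\times n$ array whose $i$-th row ($i=1,\dots,\alpha$) is the codeword of an independent data vector $\boldsymbol a_i=(a_{i,1},\dots,a_{i,k})$. There are $k\alpha$ data symbols in total. **Set transformation of an $\alpha\times\beta$ array with $\alpha\le\beta<2\alpha$.** Let the entries be $b_{i,j}$ ($1\le i\le\alpha$, $1\le j\le\beta$), and put $m=2\alpha-\beta$. For $j>m$ define the column indices $c_1(j)=2j-2\alpha+\beta-1$ and $c_2(j)=2j-2\alpha+\beta$. The transformed entries $b'_{i,j}$ are defined region by region as follows. (A) For $i,j\le m$: - $b'_{i,j}=b_{i,j}+b_{j,i}$ if $i<j$; - $b'_{i,i}=b_{i,i}$; - $b'_{i,j}=b_{i,j}+\theta_{i,j}b_{j,i}$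 if $i>j$. (B1) For $i\le m<j\le\alpha$: - $b'_{i,c_1(j)}=b_{i,c_1(j)}+b_{j,i}$; - $b'_{i,c_2(j)}=b_{i,c_2(j)}$. (B2) For $j\le m<i\le\alpha$: - $b'_{i,j}=b_{i,j}+\theta_{i,j}\bigl(b_{j,c_1(i)}+b_{j,c_2(i)}\bigr)$. (C) For $m<i,j\le\alpha$: - if $i>j$: $b'_{i,c_1(j)}=b_{i,c_1(j)}+\theta_{i,c_1(j)}b_{j,c_1(i)}$ and $b'_{i,c_2(j)}=b_{i,c_2(j)}+\theta_{i,c_2(j)}b_{j,c_2(i)}$; - if $i=j$: $b'_{i,c_1(i)}=b_{i,c_1(i)}$ and $b'_{i,c_2(i)}=b_{i,c_2(i)}$; - if $i<j$: $b'_{i,c_1(j)}=b_{i,c_1(j)}+b_{j,c_1(i)}$ and $b'_{i,c_2(j)}=b_{i,c_2(j)}+b_{j,c_2(i)}$. All $\theta$'s are coefficients in $\mathbb{F}_q\setminus\{0,1\}$. When $\beta=\alpha$ (so $m=\alpha$), only region (A) occurs. **The code ST-RS$(n,k,\alpha)$.** Let $L=\lfloor n/\alpha\rfloor$. Partition the $n$ columns of the $\alpha\times n$ base array into $L$ consecutive blocks: the first $L-1$ blocks have $\alpha$ columns each, and the last block has $\alpha+(n\bmod\alpha)$ columns (which is $<2\alpha$). Apply the set transformation independently to each block, each block having its own coefficients $\theta$. The resulting $\alpha\times n$ array is the codeword, and node $j$ stores the $\alpha$ symbols of column $j$, for $j=1,\dots,n$. *)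

theory Defs
  imports Complex_Main "HOL-Computational_Algebra.Primes"
begin

text \<open>All indices are 1-based as in the paper.  An array is a function
  row \<Rightarrow> column \<Rightarrow> symbol.\<close>

text \<open>Systematic (n,k) Reed--Solomon code with distinct evaluation points x_1..x_n:
  the codeword of data v = (v_1..v_k) is (P(x_1),...,P(x_n)) where P is the unique
  polynomial of degree < k with P(x_s) = v_s for s = 1..k (Lagrange interpolation).
  Hence positions 1..k carry the data and positions k+1..n the parities f_s(v).\<close>
definition lagrange_coeff :: "(nat \<Rightarrow> 'a::field) \<Rightarrow> nat \<Rightarrow> nat \<Rightarrow> nat \<Rightarrow> 'a" where
  "lagrange_coeff x k s j = (\<Prod>l\<in>{1..k} - {s}. (x j - x l) / (x s - x l))"

definition rs_encode :: "(nat \<Rightarrow> 'a::field) \<Rightarrow> nat \<Rightarrow> (nat \<Rightarrow> 'a) \<Rightarrow> nat \<Rightarrow> 'a" where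
  "rs_encode x k v j = (\<Sum>s\<in>{1..k}. v s * lagrange_coeff x k s j)"

definition base_array :: "(nat \<Rightarrow> 'a::field) \<Rightarrow> nat \<Rightarrow> (nat \<Rightarrow> nat \<Rightarrow> 'a) \<Rightarrow> nat \<Rightarrow> nat \<Rightarrow> 'a" where
  "base_array x k a i j = rs_encode x k (a i) j"

definition c1 :: "nat \<Rightarrow> nat \<Rightarrow> nat \<Rightarrow> nat" where
  "c1 \<alpha> \<beta> j = 2 * j + \<beta> - 2 * \<alpha> - 1"

definition c2 :: "nat \<Rightarrow> nat \<Rightarrow> nat \<Rightarrow> nat" where
  "c2 \<alpha> \<beta> j = 2 * j + \<beta> - 2 * \<alpha>"

text \<open>Set transformation of an \<alpha> x \<beta> array b (\<alpha> \<le> \<beta> < 2\<alpha>) with coefficients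
  \<theta> i j.  A column col > m equals c_1(j) (if col - m is odd) or c_2(j) (if col - m
  is even) for j = (col + m + 1) div 2.  Entries outside the array are left unchanged.\<close>
definition set_transform ::
  "nat \<Rightarrow> nat \<Rightarrow> (nat \<Rightarrow> nat \<Rightarrow> 'a::field) \<Rightarrow> (nat \<Rightarrow> nat \<Rightarrow> 'a) \<Rightarrow> nat \<Rightarrow> nat \<Rightarrow> 'a" where
  "set_transform \<alpha> \<beta> \<theta> b i col =
    (let m = 2 * \<alpha> - \<beta> in
     if i < 1 \<or> i > \<alpha> \<or> col < 1 \<or> col > \<beta> then b i col
     else if col \<le> m then
       (if i \<le> m then
          (if i < col then b i col + b col i
           else if i = col then b i i
           else b i col + \<theta> i col * b col i)
        else b i col + \<theta> i col * (b col (c1 \<alpha> \<beta> i) + b col (c2 \<alpha> \<beta> i)))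
     else
       (let j = (col + m + 1) div 2;
            cc = (if odd (col - m) then c1 \<alpha> \<beta> else c2 \<alpha> \<beta>) in
        if i \<le> m then
          (if odd (col - m) then b i col + b j i else b i col)
        else if i > j then b i col + \<theta> i col * b j (cc i)
        else if i = j then b i col
        else b i col + b j (cc i)))"

text \<open>Block structure of ST-RS(n,k,\<alpha>): L = n div \<alpha> blocks; block l (0-based) starts
  after column l*\<alpha>; blocks 0..L-2 have \<alpha> columns, block L-1 has n - (L-1)\<alpha>
  = \<alpha> + n mod \<alpha> columns.\<close>
definition block_of :: "nat \<Rightarrow> nat \<Rightarrow> nat \<Rightarrow> nat" where
  "block_of n \<alpha> j = min ((j - 1) div \<alpha>) (n div \<alpha> - 1)"

definition block_width :: "nat \<Rightarrow> nat \<Rightarrow> nat \<Rightarrow> nat" where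
  "block_width n \<alpha> l = (if l = n div \<alpha> - 1 then n - l * \<alpha> else \<alpha>)"

text \<open>The ST-RS codeword array: entry (i,j) is what node j stores in position i.
  \<theta> l i j is the coefficient \<theta>_{i,j} used in block l.\<close>
definition st_rs :: "nat \<Rightarrow> nat \<Rightarrow> nat \<Rightarrow> (nat \<Rightarrow> 'a::field) \<Rightarrow> (nat \<Rightarrow> nat \<Rightarrow> nat \<Rightarrow> 'a)
    \<Rightarrow> (nat \<Rightarrow> nat \<Rightarrow> 'a) \<Rightarrow> nat \<Rightarrow> nat \<Rightarrow> 'a" where
  "st_rs n k \<alpha> x \<theta> a i j =
    (let l = block_of n \<alpha> j; off = l * \<alpha> in
     set_transform \<alpha> (block_width n \<alpha> l) (\<theta> l)
       (\<lambda>i' c. base_array x k a i' (off + c)) i (j - off))"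

definition is_mds_array_code :: "nat \<Rightarrow> nat \<Rightarrow> nat \<Rightarrow> ((nat \<Rightarrow> nat \<Rightarrow> 'a) \<Rightarrow> nat \<Rightarrow> nat \<Rightarrow> 'a) \<Rightarrow> bool" where
  "is_mds_array_code n k \<alpha> C \<longleftrightarrow>
    (\<forall>S. S \<subseteq> {1..n} \<and> card S = k \<longrightarrow>
      (\<forall>a a'. (\<forall>i\<in>{1..\<alpha>}. \<forall>j\<in>S. C a i j = C a' i j) \<longrightarrow>
              (\<forall>i\<in>{1..\<alpha>}. \<forall>s\<in>{1..k}. a i s = a' i s)))"

end

theory Submission
  imports Defs "HOL-Computational_Algebra.Polynomial"
begin

text \<open>Every stored symbol is a base symbol \<open>(i, J)\<close> plus a multiple of a linear functional of
  one other row, the row \<open>g\<close> given by the position of column \<open>J\<close> inside its block; the multiplier is a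
  coefficient \<open>\<theta>\<close> exactly when \<open>g < i\<close>.  If all coefficients vanish, the code is triangular in the
  rows, hence MDS.  The coefficients are then changed from 0 to admissible values one at a time.
  For every set \<open>S\<close> of \<open>k\<close> nodes at most one value destroys decodability, and no value except 1 does
  if \<open>S\<close> misses the column, contains all partners of the symbol, or contains no active column
  belonging to row \<open>i\<close>.  Counting the remaining sets gives fewer than \<open>q - 2\<close> bad values, except for
  \<open>(n, k, \<alpha>) = (5, 3, 2)\<close> and \<open>(7, 3, 2)\<close>: there one more safe set is needed, and over the field
  with five elements the coefficient \<open>\<theta>\<close> of the last block of the \<open>(5, 3, 2)\<close> code has to be chosen
  by hand.\<close>

section \<open>Reed--Solomon codewords\<close>

text \<open>A column lies in \<open>(n - 1) choose (k - 1)\<close> sets of \<open>k\<close> nodes.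
  Each of them may cost one value of a coefficient and the values 0 and 1 are lost anyway, so with
  \<open>N\<close> and \<open>K\<close> the rounded-up quotients of \<open>n\<close> and
  \<open>k\<close> by \<alpha> it is enough to exhibit \<open>((N - 1) choose (K - 1)) + 2\<close>
  safe sets. The extra 2 is what makes small parameters delicate.

  The obstacle is a last block wider than \<alpha>. A symbol may then have two partners, so fewer
  sets contain all of them, and a row may own two columns of that block, so fewer sets avoid the
  row. The second column of such a pair does not enter the rows up to \<open>m\<close>; for \<alpha>
  = 2 this leaves it without any influence, and without that observation the count fails, for
  instance at \<open>(7, 4, 2)\<close>.

  A coefficient occurs in one equation only, so every decoding condition is affine in it. For
  \<open>(5, 3, 2)\<close> over five elements three such conditions remain; together with 0 and 1
  they could exclude the whole field. No count can settle this, and the actual evaluation points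
  have to be used.\<close>

lemma lagrange_coeff_node:
  assumes "inj_on x {1..n}" "k \<le> n" "s \<in> {1..k}" "j \<in> {1..k}"
  shows "lagrange_coeff x k s j = (if s = j then 1 else 0)"
proof (cases "s = j")
  case True
  have "(x j - x l) / (x s - x l) = 1" if "l \<in> {1..k} - {s}" for l
  proof -
    have "x s \<noteq> x l" using that assms by (auto dest: inj_onD)
    then show ?thesis using True by simp
  qed
  then show ?thesis using True unfolding lagrange_coeff_def by (simp add: prod.neutral)
next
  case False
  then show ?thesis using assms(4) unfolding lagrange_coeff_def
    by (auto intro!: prod_zero bexI[of _ j])
qed

lemma rs_encode_systematic:
  assumes "inj_on x {1..n}" "k \<le> n" "j \<in> {1..k}"
  shows "rs_encode x k v j = v j"
proof -
  have "rs_encode x k v j = (\<Sum>s\<in>{1..k}. if s = j then v s else 0)"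
    unfolding rs_encode_def
    by (intro sum.cong refl) (simp add: lagrange_coeff_node[OF assms(1,2) _ assms(3)])
  then show ?thesis using assms(3) by simp
qed

lemma rs_encode_poly:
  assumes "1 \<le> k"
  obtains p where "degree p < k" "\<And>j. rs_encode x k v j = poly p (x j)"
proof
  define p where "p = (\<Sum>s\<in>{1..k}. smult (v s) (\<Prod>l\<in>{1..k} - {s}. smult (1 / (x s - x l)) [:- x l, 1:]))"
  show "rs_encode x k v j = poly p (x j)" for j
    by (simp add: p_def rs_encode_def lagrange_coeff_def poly_sum poly_prod diff_divide_distrib)
  have "degree p \<le> k - 1" unfolding p_def
  proof (rule degree_sum_le)
    fix s assume s: "s \<in> {1..k}"
    have "degree (\<Prod>l\<in>{1..k} - {s}. smult (1 / (x s - x l)) [:- x l, 1:])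
        \<le> sum (degree \<circ> (\<lambda>l. smult (1 / (x s - x l)) [:- x l, 1:])) ({1..k} - {s})"
      by (rule degree_prod_sum_le) simp
    also have "\<dots> \<le> (\<Sum>l\<in>{1..k} - {s}. 1)"
      by (rule sum_mono) simp
    also have "\<dots> = k - 1" using s by simp
    finally show "degree (smult (v s) (\<Prod>l\<in>{1..k} - {s}. smult (1 / (x s - x l)) [:- x l, 1:])) \<le> k - 1"
      using degree_smult_le order.trans by blast
  qed simp
  then show "degree p < k" using assms by simp
qed

lemma rs_encode_zero: "(\<And>s. s \<in> {1..k} \<Longrightarrow> v s = 0) \<Longrightarrow> rs_encode x k v j = 0"
  unfolding rs_encode_def by simp

text \<open>A nonzero polynomial of degree below \<open>k\<close> cannot vanish at \<open>k\<close>
  distinct evaluation points. Apart from linearity, this is all that the general argument uses of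
  the Reed-Solomon code.\<close>

lemma rs_encode_inj:
  assumes "inj_on x {1..n}" "k \<le> n" "S \<subseteq> {1..n}" "card S = k"
    and zero: "\<And>j. j \<in> S \<Longrightarrow> rs_encode x k v j = 0" and s: "s \<in> {1..k}"
  shows "v s = 0"
proof -
  obtain p where p: "degree p < k" "\<And>j. rs_encode x k v j = poly p (x j)"
    using rs_encode_poly[of k x v] s by auto
  have "p = 0"
  proof (rule ccontr)
    assume "p \<noteq> 0"
    have "k = card (x ` S)"
      using assms(1,3,4) by (metis card_image inj_on_subset)
    also have "\<dots> \<le> card {y. poly p y = 0}"
      using zero p(2) by (intro card_mono poly_roots_finite \<open>p \<noteq> 0\<close>) auto
    also have "\<dots> \<le> degree p"
      using \<open>p \<noteq> 0\<close> by (rule card_poly_roots_bound)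
    finally show False using p(1) by simp
  qed
  then show ?thesis using p(2)[of s] rs_encode_systematic[OF assms(1,2) s, of v] by simp
qed

text \<open>The form with two scalars serves two purposes: cancelling one equation between two
  kernel vectors, and, with \<open>c = d = 1\<close>, reducing recovery of the data to a trivial
  kernel.\<close>

lemma base_array_lin:
  "base_array x k (\<lambda>i s. c * a i s - d * a' i s) i J
    = c * base_array x k a i J - d * base_array x k a' i J"
  unfolding base_array_def rs_encode_def
  by (simp add: sum_distrib_left sum_subtractf algebra_simps)

lemma base_array_zero: "(\<And>s. s \<in> {1..k} \<Longrightarrow> a i s = 0) \<Longrightarrow> base_array x k a i J = 0"
  unfolding base_array_def by (rule rs_encode_zero)

text \<open>Sets through a column and both kinds of safe sets are intervals of this kind. The case
  distinction matters: for \<open>card A > k\<close> the truncated lower entry would be 0 and the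
  binomial coefficient 1.\<close>

lemma card_between:
  assumes "finite B" "A \<subseteq> B"
  shows "card {S. A \<subseteq> S \<and> S \<subseteq> B \<and> card S = k}
    = (if card A \<le> k then (card B - card A) choose (k - card A) else 0)"
proof (cases "card A \<le> k")
  case True
  have fA: "finite A" using assms finite_subset by blast
  have "bij_betw (\<lambda>S. A \<union> S) {S. S \<subseteq> B - A \<and> card S = k - card A} {S. A \<subseteq> S \<and> S \<subseteq> B \<and> card S = k}"
  proof (rule bij_betw_byWitness[where f' = "\<lambda>S. S - A"])
    show "(\<lambda>S. A \<union> S) ` {S. S \<subseteq> B - A \<and> card S = k - card A} \<subseteq> {S. A \<subseteq> S \<and> S \<subseteq> B \<and> card S = k}"
    proof (intro image_subsetI CollectI conjI)
      fix S assume S: "S \<in> {S. S \<subseteq> B - A \<and> card S = k - card A}"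
      then have "finite S" using assms finite_subset by blast
      then have "card (A \<union> S) = card A + card S" using S fA by (intro card_Un_disjoint) auto
      then show "card (A \<union> S) = k" using S True by auto
    qed (use assms in auto)
    show "(\<lambda>S. S - A) ` {S. A \<subseteq> S \<and> S \<subseteq> B \<and> card S = k} \<subseteq> {S. S \<subseteq> B - A \<and> card S = k - card A}"
      using fA by (auto simp: card_Diff_subset)
  qed auto
  then have "card {S. A \<subseteq> S \<and> S \<subseteq> B \<and> card S = k} = card {S. S \<subseteq> B - A \<and> card S = k - card A}"
    using bij_betw_same_card by fastforce
  also have "\<dots> = card (B - A) choose (k - card A)" using assms by (intro n_subsets) auto
  finally show ?thesis using True assms fA by (simp add: card_Diff_subset)
next
  case False
  have "card A \<le> card S" if "A \<subseteq> S" "S \<subseteq> B" for S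
    using that assms finite_subset card_mono by metis
  then have "{S. A \<subseteq> S \<and> S \<subseteq> B \<and> card S = k} = {}" using False by auto
  then show ?thesis using False by (simp only: card.empty if_False)
qed

section \<open>Binomial estimates\<close>

lemma binomial_add_mono: "(a choose b) \<le> ((a + s + t) choose (b + s))"
proof -
  have "(a choose b) \<le> ((a + s) choose (b + s))"
    by (induction s) (auto intro: order.trans)
  also have "\<dots> \<le> ((a + s + t) choose (b + s))"
    by (intro binomial_right_mono) simp
  finally show ?thesis .
qed

text \<open>The last hypothesis is \<open>a - b \<le> c - d\<close> without subtraction: in Pascal's
  triangle one gets from \<open>(a, b)\<close> to \<open>(c, d)\<close> by raising both entries
  \<open>d - b\<close> times and then the upper entry alone.\<close>

lemma binomial_mono:
  assumes "b \<le> d" "b \<le> a" "a + d \<le> b + c"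
  shows "(a choose b) \<le> (c choose d)"
  using binomial_add_mono[of a b "d - b" "c + b - a - d"] assms by simp

lemma binomial_ge_2:
  assumes "1 \<le> b" "b < a"
  shows "2 \<le> (a choose b)"
proof -
  obtain a' b' where "a = Suc a'" "b = Suc b'" using assms by (metis One_nat_def Suc_le_D less_iff_Suc_add)
  moreover from this have "1 \<le> (a' choose b')" "1 \<le> (a' choose Suc b')"
    using assms by (simp_all add: Suc_le_eq)
  ultimately show ?thesis by simp
qed

lemma ceiling_div_bounds:
  assumes "1 \<le> a" "1 \<le> (n::nat)" "N = nat \<lceil>real n / real a\<rceil>"
  shows "a * (N - 1) < n" "n \<le> a * N" "1 \<le> N"
proof -
  let ?c = "\<lceil>real n / real a\<rceil>"
  have pos: "real n / real a > 0" using assms by simp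
  then have c: "1 \<le> ?c" by linarith
  then show "1 \<le> N" unfolding assms(3) by linarith
  have N: "real N = real_of_int ?c" using c unfolding assms(3) by simp
  have "real n / real a \<le> real N" unfolding N by linarith
  then have "real n \<le> real (a * N)" using assms(1) by (simp add: field_simps)
  then show "n \<le> a * N" by linarith
  have "real (N - 1) < real n / real a"
    using N \<open>1 \<le> N\<close> by (simp add: of_nat_diff) linarith
  then have "real (a * (N - 1)) < real n" using assms(1) by (simp add: field_simps)
  then show "a * (N - 1) < n" by linarith
qed

text \<open>The gap is \<open>(m - 2) * (m - 3) / 2\<close>, which vanishes exactly at 2 and
  3.\<close>

lemma choose_two_le: "2 * m \<le> Suc (m choose 2) + 2"
proof -
  have "2 * (m choose 2) = m * (m - 1)"
    unfolding choose_two by (cases m) simp_all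
  moreover have "4 * m \<le> m * (m - 1) + 6"
  proof (cases "m \<le> 4")
    case True
    then have "m \<in> {0,1,2,3,4}" by auto
    then show ?thesis by auto
  next
    case False
    then have "m * 4 \<le> m * (m - 1)" by (intro mult_le_mono2) auto
    then show ?thesis by linarith
  qed
  ultimately show ?thesis by linarith
qed

text \<open>Division by \<alpha> shrinks both \<open>K - 1\<close> and \<open>N - K\<close> enough
  to give a comparison with \<open>(n - 4) choose (k - 3)\<close>. The other summand of Pascal's
  rule, \<open>(n - 4) choose (k - 4)\<close>, is at least 2 and supplies the slack.\<close>

lemma choose_ceiling_bound:
  assumes "5 \<le> k" "2 \<le> \<alpha>" "k + \<alpha> \<le> n" "\<alpha> * (N - 1) < n" "n \<le> \<alpha> * N" "\<alpha> * (K - 1) < k" "k \<le> \<alpha> * K" "1 \<le> K"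
  shows "((N - 1) choose (K - 1)) + 2 \<le> ((n - 3) choose (k - 3))"
proof -
  have "2 * (K - 1) \<le> \<alpha> * (K - 1)" using assms(2) by simp
  then have K: "K - 1 \<le> k - 3" using assms(1,6) by linarith
  have KN: "K \<le> N"
  proof (rule ccontr)
    assume "\<not> K \<le> N"
    then have "\<alpha> * N \<le> \<alpha> * (K - 1)" by (intro mult_le_mono2) simp
    then show False using assms by linarith
  qed
  have NK: "N - K + 1 \<le> n - k"
  proof (cases "N = K")
    case True
    then show ?thesis using assms by simp
  next
    case False
    then have "N - 1 = K + (N - K - 1)" using KN by simp
    then have "\<alpha> * (N - 1) = \<alpha> * K + \<alpha> * (N - K - 1)" by (simp add: algebra_simps)
    moreover have "2 * (N - K - 1) \<le> \<alpha> * (N - K - 1)" using assms(2) by simp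
    ultimately have "2 * (N - K - 1) < n - k" using assms(4,7) by linarith
    then show ?thesis using assms by linarith
  qed
  have "((N - 1) choose (K - 1)) \<le> ((n - 4) choose (k - 3))"
    using K KN NK assms by (intro binomial_mono) linarith+
  moreover have "2 \<le> ((n - 4) choose (k - 4))" using assms by (intro binomial_ge_2) linarith+
  moreover have "((n - 3) choose (k - 3)) = ((n - 4) choose (k - 4)) + ((n - 4) choose (k - 3))"
  proof -
    have "n - 3 = Suc (n - 4)" "k - 3 = Suc (k - 4)" using assms by linarith+
    then show ?thesis by (simp only: binomial_Suc_Suc)
  qed
  ultimately show ?thesis by linarith
qed

lemma small_binomial: "(b::nat) \<le> 1 \<Longrightarrow> 1 \<le> a \<Longrightarrow> (a choose b) \<le> a"
  by (cases b) auto

text \<open>Here \<open>d\<close> stands for the number of partners of a symbol and \<open>g\<close>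
  for the number of active columns of its row, so the two binomials on the right count the sets
  containing all partners and the sets avoiding the row. From \<open>k = 5\<close> on the first
  family suffices; for smaller \<open>k\<close> it may be too small, hence the split on
  \<open>k\<close>.\<close>

lemma counting_bound:
  fixes n k \<alpha> N K d g q :: nat
  assumes k: "1 \<le> k" and \<alpha>: "2 \<le> \<alpha>" and n: "k + \<alpha> \<le> n" and q: "n \<le> q"
    and N: "\<alpha> * (N - 1) < n" "n \<le> \<alpha> * N" and K: "\<alpha> * (K - 1) < k" "k \<le> \<alpha> * K" "1 \<le> K"
    and bound: "((n - 1) choose (k - 1)) < q + ((N - 1) choose (K - 1))"
    and d: "d = 1 \<or> d = 2 \<and> n mod \<alpha> \<noteq> 0"
    and g: "g \<le> n div \<alpha> + 1" "\<alpha> = 2 \<longrightarrow> g \<le> n div 2"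
    and exc: "\<not> (\<alpha> = 2 \<and> k = 3 \<and> d = 2 \<and> (n = 5 \<or> n = 7))"
  shows "((n - 1) choose (k - 1)) + 2 <
    q + ((if d < k then (n - 1 - d) choose (k - 1 - d) else 0) + ((n - 1 - g) choose (k - 1)))"
proof -
  define L where "L = n div \<alpha>"
  have L: "\<alpha> * L \<le> n" "n < \<alpha> * L + \<alpha>"
  proof -
    have "n = \<alpha> * L + n mod \<alpha>" "n mod \<alpha> < \<alpha>" using \<alpha> by (simp_all add: L_def)
    then show "\<alpha> * L \<le> n" "n < \<alpha> * L + \<alpha>" by linarith+
  qed
  have N1: "2 * (N - 1) \<le> \<alpha> * (N - 1)" using \<alpha> by simp
  have N2: "2 \<le> N"
  proof (rule ccontr)
    assume "\<not> 2 \<le> N"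
    then have "\<alpha> * N \<le> \<alpha> * 1" by (intro mult_le_mono2) simp
    then show False using N(2) n k by linarith
  qed
  have L3: "3 * L \<le> n" if "\<alpha> \<noteq> 2"
  proof -
    have "3 * L \<le> \<alpha> * L" using \<alpha> that by (intro mult_le_mono1) simp
    then show ?thesis using L by linarith
  qed
  have N3: "3 * (N - 1) < n" if "\<alpha> \<noteq> 2"
  proof -
    have "3 * (N - 1) \<le> \<alpha> * (N - 1)" using \<alpha> that by (intro mult_le_mono1) simp
    then show ?thesis using N by linarith
  qed
  have gL: "g \<le> L + 1" "\<alpha> = 2 \<Longrightarrow> g \<le> L" using g by (auto simp: L_def)
  have odd_n: "n = 2 * L + 1" if "\<alpha> = 2" "d = 2" using that d unfolding L_def by presburger
  \<comment> \<open>The bound on \<open>q\<close> eliminates \<open>q\<close> and leaves a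
    comparison of binomials, with 2 for the excluded values 0 and 1. The cases \<open>k = 1\<close>
    and \<open>k = 2\<close> rest on \<open>n \<le> q\<close> instead.\<close>
  have suff: ?thesis if "((N - 1) choose (K - 1)) + 2 \<le>
      (if d < k then (n - 1 - d) choose (k - 1 - d) else 0) + ((n - 1 - g) choose (k - 1))"
    using that bound by linarith
  consider "k = 1" | "k = 2" | "k = 3" | "k = 4" | "5 \<le> k" using k by linarith
  then show ?thesis
  proof cases
    case 1
    then show ?thesis using q n \<alpha> d by auto
  next
    case 2
    have "g + d < n"
    proof (cases "\<alpha> = 2")
      case True
      then have "g \<le> L" "2 * L \<le> n" using gL L by auto
      then show ?thesis using d n 2 True odd_n by auto
    next
      case False
      have "n \<noteq> 5 \<or> L \<le> 1" using L False \<alpha> L3 by auto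
      then show ?thesis using False d n 2 gL L3[OF False] \<alpha> by linarith
    qed
    then show ?thesis using d 2 q n by auto
  next
    case 3
    have K1: "K - 1 \<le> 1"
    proof -
      have "2 * (K - 1) \<le> \<alpha> * (K - 1)" using \<alpha> by simp
      then show ?thesis using K 3 by linarith
    qed
    have K0: "K - 1 = 0" if "\<alpha> \<noteq> 2"
    proof (rule ccontr)
      assume "K - 1 \<noteq> 0"
      then have "3 * 1 \<le> \<alpha> * (K - 1)" using \<alpha> that by (intro mult_le_mono) auto
      then show False using K 3 by linarith
    qed
    have C: "((N - 1) choose (K - 1)) \<le> N - 1" using K1 N2 by (intro small_binomial) auto
    have C1: "((N - 1) choose (K - 1)) = 1" if "\<alpha> \<noteq> 2" using K0[OF that] by simp
    have two: "(m choose 2) \<ge> 3" if "3 \<le> m" for m :: nat using choose_two_le[of m] that by linarith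
    show ?thesis
    proof (cases "d = 1")
      case True
      have "((N - 1) choose (K - 1)) + 2 \<le> (n - 2) + ((n - 1 - g) choose 2)"
      proof (cases "\<alpha> = 2")
        case \<alpha>2: True
        show ?thesis
        proof (cases "n = 5")
          case True
          then have "L = 2" "N = 3" using \<alpha>2 L N by auto
          then have "g \<le> 2" using gL \<alpha>2 by simp
          then have "1 \<le> ((n - 1 - g) choose 2)" using True by (auto simp: Suc_le_eq)
          then show ?thesis using True C \<open>N = 3\<close> by simp
        next
          case False
          then have "N + 1 \<le> n - 2" using N1 N n 3 \<alpha>2 by linarith
          then show ?thesis using C N2 by linarith
        qed
      next
        case False
        then show ?thesis using C1 n 3 \<alpha> by simp
      qed
      then show ?thesis using True 3 by (intro suff) (simp add: numeral_2_eq_2)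
    next
      case False
      then have d2: "d = 2" using d by blast
      have "((N - 1) choose (K - 1)) + 2 \<le> 1 + ((n - 1 - g) choose 2)"
      proof (cases "\<alpha> = 2")
        case True
        have nL: "n = 2 * L + 1" using odd_n True d2 by blast
        \<comment> \<open>With \<open>N = L + 1\<close> the available estimates leave
          \<open>L + 2 \<le> 1 + (L choose 2)\<close>, which fails for \<open>L = 2\<close> and
          \<open>L = 3\<close>. These are the exceptional lengths 5 and 7.\<close>
        then have L4: "4 \<le> L" using exc True d2 3 n by auto
        have "N = L + 1" using N nL True by auto
        moreover have "(L choose 2) \<le> ((n - 1 - g) choose 2)"
          using gL(2)[OF True] nL L4 by (intro binomial_mono) auto
        moreover have "2 * L \<le> (L choose 2) + 3" using choose_two_le[of L] by simp
        ultimately show ?thesis using C L4 by linarith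
      next
        case False
        \<comment> \<open>Only at \<open>n = 6\<close> would the bounds on \<open>g\<close> leave
          fewer than three columns. There \<alpha> = 3 divides \<open>n\<close>, so two partners
          cannot occur.\<close>
        have "n \<noteq> 6"
        proof
          assume "n = 6"
          then have "\<alpha> = 3" using n 3 False \<alpha> by simp
          then show False using \<open>n = 6\<close> d d2 by simp
        qed
        then have "3 \<le> n - 1 - g" using gL(1) L3[OF False] n 3 False \<alpha> by linarith
        then show ?thesis using two C1[OF False] by fastforce
      qed
      then show ?thesis using d2 3 by (intro suff) simp
    qed
  next
    case 4
    have K1: "K - 1 \<le> 1"
    proof -
      have "2 * (K - 1) \<le> \<alpha> * (K - 1)" using \<alpha> by simp
      then show ?thesis using K 4 by linarith
    qed
    have C: "((N - 1) choose (K - 1)) \<le> N - 1" using K1 N2 by (intro small_binomial) auto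
    show ?thesis
    proof (cases "d = 1")
      case True
      have "N + 1 \<le> ((n - 2) choose 2)" using choose_two_le[of "n - 2"] n 4 \<alpha> N N1 by linarith
      then show ?thesis using C N2 True 4 by (intro suff) (simp add: numeral_2_eq_2)
    next
      case False
      then have d2: "d = 2" using d by blast
      have "N + 1 \<le> (n - 3) + ((n - 1 - g) choose 3)"
      proof (cases "\<alpha> = 2")
        case True
        have nL: "n = 2 * L + 1" using odd_n True d2 by blast
        have "N = L + 1" using N nL True by auto
        show ?thesis
        proof (cases "L = 3")
          case True
          then have "3 \<le> n - 1 - g" using nL gL(2)[OF \<open>\<alpha> = 2\<close>] by simp
          then have "1 \<le> ((n - 1 - g) choose 3)" by (simp add: Suc_le_eq)
          then show ?thesis using nL True \<open>N = L + 1\<close> by simp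
        next
          case False
          then show ?thesis using nL n 4 \<open>N = L + 1\<close> \<alpha> by linarith
        qed
      next
        case False
        then show ?thesis using N3[OF False] n 4 \<alpha> by linarith
      qed
      then show ?thesis using C N2 d2 4 by (intro suff) simp
    qed
  next
    case 5
    have 1: "((N - 1) choose (K - 1)) + 2 \<le> ((n - 3) choose (k - 3))"
      using choose_ceiling_bound[OF 5 \<alpha> n N K] .
    have "((n - 3) choose (k - 3)) \<le> ((n - 1 - d) choose (k - 1 - d))"
      using d 5 n \<alpha> by (intro binomial_mono) auto
    moreover have "d < k" using d 5 by auto
    ultimately show ?thesis using 1 by (intro suff) simp
  qed
qed

section \<open>Arrays with pairwise coupled rows\<close>

text \<open>\<open>grp J\<close> is the row whose data enter the other symbols of column
  \<open>J\<close>, and \<open>cpl i J\<close> lists the columns at which that row is read in the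
  symbol \<open>(i, J)\<close>. Coupling there and back is required in summed form, for every
  \<open>\<phi>\<close>, because of two partners only one may point back.\<close>

locale coupled_array =
  fixes n k \<alpha> :: nat and x :: "nat \<Rightarrow> 'a::{finite,field}"
    and grp :: "nat \<Rightarrow> nat" and cpl :: "nat \<Rightarrow> nat \<Rightarrow> nat set"
  assumes inj: "inj_on x {1..n}" and k_le_n: "k \<le> n"
    and grp_range: "J \<in> {1..n} \<Longrightarrow> grp J \<in> {1..\<alpha>}"
    and cpl_grp: "\<lbrakk>J \<in> {1..n}; i \<in> {1..\<alpha>}; i \<noteq> grp J; J' \<in> cpl i J\<rbrakk>
      \<Longrightarrow> J' \<in> {1..n} \<and> grp J' = i"
    and cpl_cpl: "\<lbrakk>J \<in> {1..n}; i \<in> {1..\<alpha>}; grp J < i\<rbrakk>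
      \<Longrightarrow> (\<Sum>J'\<in>cpl i J. \<Sum>J''\<in>cpl (grp J) J'. (\<phi> :: nat \<Rightarrow> 'a) J'') = \<phi> J"
begin

definition partner :: "(nat \<Rightarrow> nat \<Rightarrow> 'a) \<Rightarrow> nat \<Rightarrow> nat \<Rightarrow> 'a" where
  "partner a i J = (\<Sum>J'\<in>cpl i J. base_array x k a (grp J) J')"

text \<open>The fixed coefficients 1 and 0 are built in, and only the positions below
  \<open>grp J\<close> read \<open>\<tau>\<close>. This lets a coefficient take the inadmissible
  value 0 as an intermediate state.\<close>

definition symbol :: "(nat \<times> nat \<Rightarrow> 'a) \<Rightarrow> (nat \<Rightarrow> nat \<Rightarrow> 'a) \<Rightarrow> nat \<Rightarrow> nat \<Rightarrow> 'a" where
  "symbol \<tau> a i J = base_array x k a i J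
    + (if i < grp J then 1 else if i = grp J then 0 else \<tau> (i, J)) * partner a i J"

text \<open>A column that enters no other row can be ignored when deciding which rows have to be
  decoded jointly; the remaining rows are then read off directly.\<close>

definition active :: "nat \<Rightarrow> bool" where
  "active J \<longleftrightarrow> (\<exists>i\<in>{1..\<alpha>}. i \<noteq> grp J \<and> cpl i J \<noteq> {})"

definition rows :: "nat set \<Rightarrow> nat set" where
  "rows S = grp ` {J \<in> S. active J}"

text \<open>The equations of the rows in \<open>rows S\<close> form a closed system: an active
  column of \<open>S\<close> couples only to a row in \<open>rows S\<close>, an inactive one to no
  other row. Hence a coefficient in a row outside \<open>rows S\<close> cannot affect
  \<open>S\<close>.\<close>

definition decodes :: "(nat \<times> nat \<Rightarrow> 'a) \<Rightarrow> nat set \<Rightarrow> bool" where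
  "decodes \<tau> S \<longleftrightarrow> (\<forall>a. (\<forall>i\<in>rows S. \<forall>J\<in>S. symbol \<tau> a i J = 0) \<longrightarrow>
     (\<forall>i\<in>rows S. \<forall>s\<in>{1..k}. a i s = 0))"

definition k_sets :: "nat set set" where
  "k_sets = {S. S \<subseteq> {1..n} \<and> card S = k}"

definition positions :: "(nat \<times> nat) set" where
  "positions = {(i, J). i \<in> {1..\<alpha>} \<and> J \<in> {1..n} \<and> grp J < i}"

lemma finite_k_sets: "finite k_sets"
  by (rule finite_subset[of _ "Pow {1..n}"]) (auto simp: k_sets_def)

lemma finite_positions: "finite positions"
  by (rule finite_subset[of _ "{1..\<alpha>} \<times> {1..n}"]) (auto simp: positions_def)

lemma rows_range: "S \<in> k_sets \<Longrightarrow> i \<in> rows S \<Longrightarrow> i \<in> {1..\<alpha>}"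
  using grp_range by (fastforce simp: k_sets_def rows_def)

lemma base_array_inj:
  assumes "S \<in> k_sets" "\<And>J. J \<in> S \<Longrightarrow> base_array x k a i J = 0" "s \<in> {1..k}"
  shows "a i s = 0"
  using rs_encode_inj[OF inj k_le_n, of S "a i" s] assms by (auto simp: k_sets_def base_array_def)

lemma partner_lin: "partner (\<lambda>i s. c * a i s - d * a' i s) i J = c * partner a i J - d * partner a' i J"
  by (simp add: partner_def base_array_lin sum_subtractf sum_distrib_left)

lemma partner_zero: "(\<And>s. s \<in> {1..k} \<Longrightarrow> a (grp J) s = 0) \<Longrightarrow> partner a i J = 0"
  unfolding partner_def by (intro sum.neutral ballI base_array_zero)

lemma symbol_lin:
  "symbol \<tau> (\<lambda>i s. c * a i s - d * a' i s) i J = c * symbol \<tau> a i J - d * symbol \<tau> a' i J"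
  by (simp add: symbol_def partner_lin base_array_lin algebra_simps)

lemma symbol_upd: "(i, J) \<noteq> p \<Longrightarrow> symbol (\<tau>(p := t)) a i J = symbol \<tau> a i J"
  by (auto simp: symbol_def)

lemma symbol_eq_base:
  assumes "i \<in> {1..\<alpha>}" "\<And>s. \<lbrakk>active J; s \<in> {1..k}\<rbrakk> \<Longrightarrow> a (grp J) s = 0"
  shows "symbol \<tau> a i J = base_array x k a i J"
proof (cases "i = grp J \<or> active J")
  case True
  then have "i = grp J \<or> partner a i J = 0" using assms(2) partner_zero by blast
  then show ?thesis by (auto simp: symbol_def)
next
  case False
  then have "cpl i J = {}" using assms(1) by (auto simp: active_def)
  then show ?thesis by (simp add: symbol_def partner_def)
qed

lemma decodes_all_rows:
  assumes "decodes \<tau> S" "S \<in> k_sets" and zero: "\<And>i J. \<lbrakk>i \<in> {1..\<alpha>}; J \<in> S\<rbrakk> \<Longrightarrow> symbol \<tau> a i J = 0"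
    and "i \<in> {1..\<alpha>}" "s \<in> {1..k}"
  shows "a i s = 0"
proof -
  have rows0: "a i s = 0" if "i \<in> rows S" "s \<in> {1..k}" for i s
    using assms(1) that zero rows_range[OF assms(2)] by (auto simp: decodes_def)
  show ?thesis
  proof (rule base_array_inj[OF assms(2) _ assms(5)])
    fix J assume J: "J \<in> S"
    have "symbol \<tau> a i J = base_array x k a i J"
      using J by (intro symbol_eq_base assms(4) rows0) (auto simp: rows_def)
    then show "base_array x k a i J = 0" using zero[OF assms(4) J] by simp
  qed
qed

text \<open>With vanishing coefficients the code is triangular: row \<open>i\<close> only involves rows
  \<open>\<ge> i\<close>, so the rows can be decoded from the last one upwards.\<close>

lemma decodes_zero:
  assumes "S \<in> k_sets"
  shows "decodes (\<lambda>_. 0) S"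
  unfolding decodes_def
proof (intro allI impI)
  fix a assume *: "\<forall>i\<in>rows S. \<forall>J\<in>S. symbol (\<lambda>_. 0) a i J = 0"
  have "i \<in> rows S \<Longrightarrow> (\<forall>s\<in>{1..k}. a i s = 0)" for i
  proof (induction "\<alpha> - i" arbitrary: i rule: less_induct)
    case less
    have i: "i \<in> {1..\<alpha>}" using rows_range[OF assms less.prems] .
    show ?case
    proof
      fix s assume s: "s \<in> {1..k}"
      show "a i s = 0"
      proof (rule base_array_inj[OF assms _ s])
        fix J assume J: "J \<in> S"
        have "symbol (\<lambda>_. 0) a i J = base_array x k a i J"
        proof (cases "i < grp J \<and> active J")
          case True
          have "grp J \<in> {1..\<alpha>}" using J assms grp_range by (auto simp: k_sets_def)
          then have "a (grp J) s = 0" if "s \<in> {1..k}" for s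
            using less.hyps[of "grp J"] True J i that by (auto simp: rows_def)
          then show ?thesis by (intro symbol_eq_base i)
        next
          case False
          then show ?thesis using symbol_eq_base[OF i, of J a] by (cases "active J") (auto simp: symbol_def)
        qed
        then show "base_array x k a i J = 0" using * less.prems J by auto
      qed
    qed
  qed
  then show "\<forall>i\<in>rows S. \<forall>s\<in>{1..k}. a i s = 0" by blast
qed

lemma decodes_upd_notin:
  assumes "decodes \<tau> S" "i0 \<notin> rows S \<or> J0 \<notin> S"
  shows "decodes (\<tau>((i0, J0) := t)) S"
proof -
  have "symbol (\<tau>((i0, J0) := t)) a i J = symbol \<tau> a i J" if "i \<in> rows S" "J \<in> S" for a i J
    using that assms(2) by (intro symbol_upd) auto
  then show ?thesis using assms(1) by (simp add: decodes_def)
qed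

text \<open>At the constant function 1 the identity \<open>cpl_cpl\<close> reads 1, whereas an empty
  \<open>cpl i0 J0\<close> would give 0.\<close>

lemma active_position:
  assumes "(i0, J0) \<in> positions"
  shows "cpl i0 J0 \<noteq> {}" "active J0"
proof -
  have "(\<Sum>J'\<in>cpl i0 J0. \<Sum>J''\<in>cpl (grp J0) J'. (1::'a)) = 1"
    using cpl_cpl[of J0 i0 "\<lambda>_. 1"] assms by (auto simp: positions_def)
  then show "cpl i0 J0 \<noteq> {}" by auto
  then show "active J0" using assms unfolding active_def positions_def
    by (intro bexI[of _ i0]) auto
qed

text \<open>If all partners of an entry are available, then the entry and its partners can be
  uncoupled as long as the coefficient is not 1.\<close>

lemma decodes_upd_partners:
  assumes "decodes \<tau> S" "(i0, J0) \<in> positions" "J0 \<in> S" "cpl i0 J0 \<subseteq> S" "t \<noteq> 1"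
  shows "decodes (\<tau>((i0, J0) := t)) S"
proof (cases "i0 \<in> rows S")
  case False
  then show ?thesis using assms(1) decodes_upd_notin by blast
next
  case True
  let ?g = "grp J0" and ?\<tau> = "\<tau>((i0, J0) := t)"
  have pos: "i0 \<in> {1..\<alpha>}" "J0 \<in> {1..n}" "?g < i0" using assms(2) by (auto simp: positions_def)
  have g: "?g \<in> rows S" using active_position[OF assms(2)] assms(3) by (auto simp: rows_def)
  show ?thesis unfolding decodes_def
  proof (intro allI impI)
    fix a assume *: "\<forall>i\<in>rows S. \<forall>J\<in>S. symbol ?\<tau> a i J = 0"
    have 1: "base_array x k a i0 J0 + t * partner a i0 J0 = 0"
      using *[rule_format, OF True assms(3)] pos by (simp add: symbol_def)
    have "base_array x k a ?g J' + (\<Sum>J''\<in>cpl ?g J'. base_array x k a i0 J'') = 0"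
      if "J' \<in> cpl i0 J0" for J'
    proof -
      have "grp J' = i0" using cpl_grp[OF pos(2,1) _ that] pos by auto
      then show ?thesis using *[rule_format, OF g, of J'] that assms(4) pos
        by (auto simp: symbol_def partner_def)
    qed
    \<comment> \<open>Adding the equations of all partners makes the back-couplings collapse to the
      entry \<open>(i0, J0)\<close> itself, by \<open>cpl_cpl\<close>. The result is the original
      equation with coefficient 1, so \<open>t \<noteq> 1\<close> separates the entry from its
      partner sum.\<close>
    then have "(\<Sum>J'\<in>cpl i0 J0. base_array x k a ?g J' + (\<Sum>J''\<in>cpl ?g J'. base_array x k a i0 J'')) = 0"
      by simp
    then have 2: "partner a i0 J0 + base_array x k a i0 J0 = 0"
      by (simp add: sum.distrib partner_def cpl_cpl[OF pos(2,1,3)])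
    have "(t - 1) * partner a i0 J0 = (base_array x k a i0 J0 + t * partner a i0 J0)
        - (partner a i0 J0 + base_array x k a i0 J0)" by (simp add: algebra_simps)
    then have "(t - 1) * partner a i0 J0 = 0" using 1 2 by simp
    then have "partner a i0 J0 = 0" using assms(5) by simp
    then have "symbol \<tau> a i0 J0 = 0" using 1 pos by (simp add: symbol_def)
    then have "\<forall>i\<in>rows S. \<forall>J\<in>S. symbol \<tau> a i J = 0"
      using * symbol_upd by (metis prod.inject)
    then show "\<forall>i\<in>rows S. \<forall>s\<in>{1..k}. a i s = 0" using assms(1) by (auto simp: decodes_def)
  qed
qed

text \<open>Dropping the equation that contains the coefficient leaves a kernel of dimension at most
  one, so at most one value of the coefficient destroys decodability.\<close>

lemma decodes_upd_unique:
  assumes dec: "decodes \<tau> S" and pos: "(i0, J0) \<in> positions" and "J0 \<in> S" and "\<tau> (i0, J0) = 0"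
    and t: "\<not> decodes (\<tau>((i0, J0) := t)) S" and t': "\<not> decodes (\<tau>((i0, J0) := t')) S"
  shows "t = t'"
proof -
  have "i0 \<in> rows S" using t decodes_upd_notin[OF dec] by blast
  have g: "grp J0 \<in> rows S" using active_position[OF pos] assms(3) by (auto simp: rows_def)
  have i0: "grp J0 < i0" using pos by (auto simp: positions_def)
  have witness: "\<exists>a. (\<forall>i\<in>rows S. \<forall>J\<in>S. (i, J) \<noteq> (i0, J0) \<longrightarrow> symbol \<tau> a i J = 0) \<and>
      symbol \<tau> a i0 J0 + u * partner a i0 J0 = 0 \<and> symbol \<tau> a i0 J0 \<noteq> 0"
    if u: "\<not> decodes (\<tau>((i0, J0) := u)) S" for u
  proof -
    obtain a i s where a: "\<forall>i\<in>rows S. \<forall>J\<in>S. symbol (\<tau>((i0, J0) := u)) a i J = 0"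
      and nz: "i \<in> rows S" "s \<in> {1..k}" "a i s \<noteq> 0"
      using u unfolding decodes_def by blast
    have 1: "\<forall>i\<in>rows S. \<forall>J\<in>S. (i, J) \<noteq> (i0, J0) \<longrightarrow> symbol \<tau> a i J = 0"
      using a symbol_upd by metis
    moreover have "symbol \<tau> a i0 J0 + u * partner a i0 J0 = 0"
      using a[rule_format, OF \<open>i0 \<in> rows S\<close> assms(3)] assms(4) i0 by (simp add: symbol_def)
    moreover have "symbol \<tau> a i0 J0 \<noteq> 0"
    proof
      assume "symbol \<tau> a i0 J0 = 0"
      then have "\<forall>i\<in>rows S. \<forall>J\<in>S. symbol \<tau> a i J = 0" using 1 by auto
      then show False using dec nz unfolding decodes_def by blast
    qed
    ultimately show ?thesis by blast
  qed
  obtain a where a: "\<forall>i\<in>rows S. \<forall>J\<in>S. (i, J) \<noteq> (i0, J0) \<longrightarrow> symbol \<tau> a i J = 0"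
      "symbol \<tau> a i0 J0 + t * partner a i0 J0 = 0" "symbol \<tau> a i0 J0 \<noteq> 0"
    using witness[OF t] by blast
  obtain a' where a': "\<forall>i\<in>rows S. \<forall>J\<in>S. (i, J) \<noteq> (i0, J0) \<longrightarrow> symbol \<tau> a' i J = 0"
      "symbol \<tau> a' i0 J0 + t' * partner a' i0 J0 = 0" "symbol \<tau> a' i0 J0 \<noteq> 0"
    using witness[OF t'] by blast
  \<comment> \<open>These scalars make the one dropped equation cancel too, so \<open>e\<close>
    solves the full system for \<open>\<tau>\<close> and vanishes on the rows involved. Then
    \<open>c * partner a = d * partner a'\<close>, and inserting the two modified equations for
    \<open>c\<close> and \<open>d\<close> forces \<open>t = t'\<close>.\<close>
  define c d where "c = symbol \<tau> a' i0 J0" and "d = symbol \<tau> a i0 J0"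
  define e where "e = (\<lambda>i s. c * a i s - d * a' i s)"
  have "symbol \<tau> e i J = 0" if "i \<in> rows S" "J \<in> S" for i J
    using that a(1) a'(1) unfolding e_def symbol_lin
    by (cases "(i, J) = (i0, J0)") (auto simp: c_def d_def)
  then have "\<forall>s\<in>{1..k}. e (grp J0) s = 0" using dec g unfolding decodes_def by blast
  then have "partner e i0 J0 = 0" by (intro partner_zero) auto
  then have "c * partner a i0 J0 = d * partner a' i0 J0" by (simp add: e_def partner_lin)
  moreover have c: "c = - (t' * partner a' i0 J0)" and d: "d = - (t * partner a i0 J0)"
    using a(2) a'(2) by (simp_all add: c_def d_def eq_neg_iff_add_eq_0)
  ultimately have "(t' - t) * (partner a i0 J0 * partner a' i0 J0) = 0" by (simp add: algebra_simps)
  moreover have "partner a i0 J0 \<noteq> 0" "partner a' i0 J0 \<noteq> 0"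
    using a(3) a'(3) c d by (auto simp: c_def d_def)
  ultimately show ?thesis by simp
qed

section \<open>Choosing the coefficients one at a time\<close>

definition good :: "(nat \<times> nat \<Rightarrow> 'a) \<Rightarrow> bool" where
  "good \<tau> \<longleftrightarrow> (\<forall>p. \<tau> p \<noteq> 1) \<and> (\<forall>S\<in>k_sets. decodes \<tau> S)"

definition safe :: "(nat \<times> nat \<Rightarrow> 'a) \<Rightarrow> nat \<times> nat \<Rightarrow> nat set set" where
  "safe \<tau> p = {S \<in> k_sets. snd p \<in> S \<and> (\<forall>t. t \<noteq> 1 \<longrightarrow> decodes (\<tau>(p := t)) S)}"

lemma good_zero: "good (\<lambda>_. 0)"
  by (simp add: good_def decodes_zero)

text \<open>Each set through the column that is not safe excludes at most one value; the summand 2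
  pays for the values 0 and 1.\<close>

lemma good_step:
  assumes "good \<tau>" "p \<in> positions" "\<tau> p = 0"
    and count: "card {S \<in> k_sets. snd p \<in> S} + 2 < card (UNIV :: 'a set) + card (safe \<tau> p)"
  obtains t where "t \<noteq> 0" "t \<noteq> 1" "good (\<tau>(p := t))"
proof -
  obtain i0 J0 where p: "p = (i0, J0)" by (cases p)
  define U where "U = {S \<in> k_sets. snd p \<in> S} - safe \<tau> p"
  define B where "B S = {t. \<not> decodes (\<tau>(p := t)) S}" for S
  have finU: "finite U" using finite_k_sets by (simp add: U_def)
  have "card (B S) \<le> 1" if "S \<in> U" for S
  proof -
    have "decodes \<tau> S" "J0 \<in> S" using that assms(1) p by (auto simp: U_def good_def)
    then have "t = t'" if "t \<in> B S" "t' \<in> B S" for t t'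
      using decodes_upd_unique[of \<tau> S i0 J0 t t'] that assms(2,3) p by (auto simp: B_def)
    then show ?thesis by (auto simp: card_le_Suc0_iff_eq)
  qed
  then have "card (\<Union>S\<in>U. B S) \<le> card U"
    using card_UN_le[OF finU, of B] sum_mono[of U "\<lambda>S. card (B S)" "\<lambda>_. 1"] by simp
  moreover have "card U = card {S \<in> k_sets. snd p \<in> S} - card (safe \<tau> p)"
    unfolding U_def using finite_k_sets
    by (intro card_Diff_subset) (auto simp: safe_def)
  moreover have "card (safe \<tau> p) \<le> card {S \<in> k_sets. snd p \<in> S}"
    using finite_k_sets by (intro card_mono) (auto simp: safe_def)
  moreover have "card ({0, 1} \<union> (\<Union>S\<in>U. B S)) \<le> 2 + card (\<Union>S\<in>U. B S)"
    by (rule order.trans[OF card_Un_le]) simp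
  ultimately have "card ({0, 1} \<union> (\<Union>S\<in>U. B S)) < card (UNIV :: 'a set)" using count by linarith
  then have "{0, 1} \<union> (\<Union>S\<in>U. B S) \<noteq> UNIV" by (metis less_irrefl)
  then obtain t where t: "t \<noteq> 0" "t \<noteq> 1" "\<And>S. S \<in> U \<Longrightarrow> t \<notin> B S" by auto
  have "decodes (\<tau>(p := t)) S" if "S \<in> k_sets" for S
  proof (cases "J0 \<in> S")
    case True
    then show ?thesis using t that by (auto simp: U_def B_def safe_def p)
  next
    case False
    then show ?thesis using assms(1) that decodes_upd_notin by (auto simp: good_def p)
  qed
  then have "good (\<tau>(p := t))" using t assms(1) by (auto simp: good_def)
  then show ?thesis using t that by blast
qed

text \<open>The count is demanded for every good state, so the order of the positions does not
  matter. The start is arbitrary off \<open>P\<close> because over five elements one coefficient is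
  already set when the filling begins.\<close>

lemma good_fill:
  assumes "finite P" "P \<subseteq> positions" "good \<tau>" "\<And>p. p \<in> P \<Longrightarrow> \<tau> p = 0"
    and count: "\<And>\<tau> p. \<lbrakk>p \<in> P; good \<tau>\<rbrakk> \<Longrightarrow>
      card {S \<in> k_sets. snd p \<in> S} + 2 < card (UNIV :: 'a set) + card (safe \<tau> p)"
  shows "\<exists>\<sigma>. good \<sigma> \<and> (\<forall>p\<in>P. \<sigma> p \<noteq> 0) \<and> (\<forall>p. p \<notin> P \<longrightarrow> \<sigma> p = \<tau> p)"
  using assms
proof (induction P rule: finite_induct)
  case empty
  then show ?case by auto
next
  case (insert p P)
  then obtain \<sigma> where \<sigma>: "good \<sigma>" "\<forall>p\<in>P. \<sigma> p \<noteq> 0" "\<forall>p. p \<notin> P \<longrightarrow> \<sigma> p = \<tau> p"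
    by auto
  have "p \<in> positions" "\<sigma> p = 0" using \<sigma>(3) insert.prems(1,3) insert.hyps by (blast, metis insertI1)
  then obtain t where t: "t \<noteq> 0" "good (\<sigma>(p := t))"
    using good_step[of \<sigma> p] \<sigma>(1) insert.prems(4)[of p \<sigma>] by blast
  moreover have "\<forall>p'\<in>insert p P. (\<sigma>(p := t)) p' \<noteq> 0"
    "\<forall>p'. p' \<notin> insert p P \<longrightarrow> (\<sigma>(p := t)) p' = \<tau> p'"
    using \<sigma> t(1) by simp_all
  ultimately show ?case by blast
qed

section \<open>Counting safe node sets\<close>

lemma card_safe_families:
  assumes "good \<tau>" "(i0, J0) \<in> positions" "1 \<le> k"
    and G: "G = {J \<in> {1..n}. grp J = i0 \<and> active J}"
    and F: "F = {S. insert J0 (cpl i0 J0) \<subseteq> S \<and> S \<subseteq> {1..n} \<and> card S = k}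
      \<union> {S. {J0} \<subseteq> S \<and> S \<subseteq> {1..n} - G \<and> card S = k}"
  shows "F \<subseteq> safe \<tau> (i0, J0)"
    and "card F = (if card (cpl i0 J0) < k
        then (n - 1 - card (cpl i0 J0)) choose (k - 1 - card (cpl i0 J0)) else 0)
      + ((n - 1 - card G) choose (k - 1))"
proof -
  let ?D = "cpl i0 J0"
  have pos: "i0 \<in> {1..\<alpha>}" "J0 \<in> {1..n}" "grp J0 < i0" using assms(2) by (auto simp: positions_def)
  have D: "?D \<subseteq> {J \<in> {1..n}. grp J = i0}" using cpl_grp[OF pos(2,1)] pos(3) by auto
  have act: "active J" if J: "J \<in> ?D" "cpl (grp J0) J \<noteq> {}" for J
  proof -
    have "grp J = i0" using J D by auto
    then show ?thesis using J pos grp_range[OF pos(2)] unfolding active_def by (intro bexI[of _ "grp J0"]) auto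
  qed
  \<comment> \<open>Some partner points back to \<open>J0\<close>, again by \<open>cpl_cpl\<close>
    at the constant 1, and is therefore active. A set containing all partners then meets
    \<open>G\<close>, so the two families are disjoint and their sizes add up.\<close>
  have DG: "?D \<inter> G \<noteq> {}"
  proof
    assume "?D \<inter> G = {}"
    then have "cpl (grp J0) J = {}" if "J \<in> ?D" for J using act D that G by auto
    then have "(\<Sum>J'\<in>?D. \<Sum>J''\<in>cpl (grp J0) J'. (1::'a)) = 0" by (intro sum.neutral) simp
    then show False using cpl_cpl[OF pos(2,1,3), of "\<lambda>_. 1"] by simp
  qed
  have dec: "decodes \<tau> S" if "S \<in> k_sets" for S using assms(1) that by (simp add: good_def)
  have 1: "S \<in> safe \<tau> (i0, J0)" if "insert J0 ?D \<subseteq> S" "S \<subseteq> {1..n}" "card S = k" for S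
    using that dec decodes_upd_partners[OF _ assms(2)] by (auto simp: safe_def k_sets_def)
  have 2: "S \<in> safe \<tau> (i0, J0)" if S: "{J0} \<subseteq> S" "S \<subseteq> {1..n} - G" "card S = k" for S
  proof -
    have "i0 \<notin> rows S" using S(2) G by (auto simp: rows_def)
    moreover have "S \<in> k_sets" using S by (auto simp: k_sets_def)
    ultimately show ?thesis using S(1) dec decodes_upd_notin by (auto simp: safe_def)
  qed
  show "F \<subseteq> safe \<tau> (i0, J0)" unfolding F using 1 2 by blast
  have fD: "finite ?D" using D finite_subset by fastforce
  have J0: "J0 \<notin> ?D" "J0 \<notin> G" using D pos G by auto
  have "card F = card {S. insert J0 ?D \<subseteq> S \<and> S \<subseteq> {1..n} \<and> card S = k}
      + card {S. {J0} \<subseteq> S \<and> S \<subseteq> {1..n} - G \<and> card S = k}"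
    unfolding F
  proof (rule card_Un_disjoint)
    show "finite {S. insert J0 ?D \<subseteq> S \<and> S \<subseteq> {1..n} \<and> card S = k}"
      "finite {S. {J0} \<subseteq> S \<and> S \<subseteq> {1..n} - G \<and> card S = k}"
      by (rule finite_subset[of _ "Pow {1..n}"]; blast)+
    show "{S. insert J0 ?D \<subseteq> S \<and> S \<subseteq> {1..n} \<and> card S = k}
      \<inter> {S. {J0} \<subseteq> S \<and> S \<subseteq> {1..n} - G \<and> card S = k} = {}" using DG by blast
  qed
  also have "card {S. insert J0 ?D \<subseteq> S \<and> S \<subseteq> {1..n} \<and> card S = k}
      = (if card ?D < k then (n - 1 - card ?D) choose (k - 1 - card ?D) else 0)"
  proof -
    have "insert J0 ?D \<subseteq> {1..n}" using D pos by blast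
    then show ?thesis using J0(1) fD card_between[of "{1..n}" "insert J0 ?D" k] by simp
  qed
  also have "card {S. {J0} \<subseteq> S \<and> S \<subseteq> {1..n} - G \<and> card S = k} = (n - 1 - card G) choose (k - 1)"
  proof -
    have "card ({1..n} - G) = n - card G" using G by (subst card_Diff_subset) auto
    moreover have "{J0} \<subseteq> {1..n} - G" using pos J0 by blast
    ultimately show ?thesis using assms(3) card_between[of "{1..n} - G" "{J0}" k]
      by (simp add: diff_commute)
  qed
  finally show "card F = (if card ?D < k then (n - 1 - card ?D) choose (k - 1 - card ?D) else 0)
      + ((n - 1 - card G) choose (k - 1))" .
qed

lemma card_k_sets_containing:
  assumes "J \<in> {1..n}" "1 \<le> k"
  shows "card {S \<in> k_sets. J \<in> S} = (n - 1) choose (k - 1)"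
proof -
  have "{S \<in> k_sets. J \<in> S} = {S. {J} \<subseteq> S \<and> S \<subseteq> {1..n} \<and> card S = k}" by (auto simp: k_sets_def)
  then show ?thesis using assms card_between[of "{1..n}" "{J}" k] by simp
qed

end

section \<open>The set transformation\<close>

definition loc_grp :: "nat \<Rightarrow> nat \<Rightarrow> nat \<Rightarrow> nat" where
  "loc_grp \<alpha> \<beta> c = (let m = 2 * \<alpha> - \<beta> in if c \<le> m then c else (c + m + 1) div 2)"

text \<open>The empty case is the second column of a pair in a row up to \<open>m\<close>, where the
  transformation leaves the entry unchanged. This asymmetry is why only one of two partners points
  back. The value at the column's own row is harmless, as it is multiplied by 0.\<close>

definition loc_cpl :: "nat \<Rightarrow> nat \<Rightarrow> nat \<Rightarrow> nat \<Rightarrow> nat set" where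
  "loc_cpl \<alpha> \<beta> i c = (let m = 2 * \<alpha> - \<beta> in
     if c \<le> m then (if i \<le> m then {i} else {c1 \<alpha> \<beta> i, c2 \<alpha> \<beta> i})
     else if i \<le> m then (if odd (c - m) then {i} else {})
     else {if odd (c - m) then c1 \<alpha> \<beta> i else c2 \<alpha> \<beta> i})"

text \<open>Writing the columns beyond \<open>m\<close> as \<open>m + 2 * t + 1\<close> and
  \<open>m + 2 * t + 2\<close> turns them into \<open>c1\<close> and \<open>c2\<close> of
  \<open>j = m + t + 1\<close> and removes all truncated subtractions.\<close>

lemma loc_column_cases:
  assumes "\<alpha> \<le> \<beta>" "\<beta> < 2 * \<alpha>" "c \<in> {1..\<beta>}"
  obtains (single) "c \<le> 2 * \<alpha> - \<beta>" "loc_grp \<alpha> \<beta> c = c"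
  | (first) j where "2 * \<alpha> - \<beta> < j" "j \<le> \<alpha>" "c = c1 \<alpha> \<beta> j" "loc_grp \<alpha> \<beta> c = j"
      "2 * \<alpha> - \<beta> < c" "odd (c - (2 * \<alpha> - \<beta>))"
  | (second) j where "2 * \<alpha> - \<beta> < j" "j \<le> \<alpha>" "c = c2 \<alpha> \<beta> j" "loc_grp \<alpha> \<beta> c = j"
      "2 * \<alpha> - \<beta> < c" "even (c - (2 * \<alpha> - \<beta>))"
proof -
  define m where "m = 2 * \<alpha> - \<beta>"
  have \<beta>: "\<beta> = 2 * \<alpha> - m" "m \<le> \<alpha>" "0 < m" using assms by (auto simp: m_def)
  consider "c \<le> m" | t where "c = m + 2 * t + 1" | t where "c = m + 2 * t + 2"
  proof -
    have "c \<le> m \<or> (\<exists>t. c = m + 2 * t + 1) \<or> (\<exists>t. c = m + 2 * t + 2)" by presburger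
    then show ?thesis using that by blast
  qed
  then show ?thesis
  proof cases
    case 1
    then show ?thesis using single by (simp add: loc_grp_def m_def)
  next
    case (2 t)
    have "(c + m + 1) div 2 = m + t + 1" using 2 by simp
    then show ?thesis using 2 \<beta> assms(3)
      by (intro first[of "m + t + 1"]) (auto simp: loc_grp_def c1_def m_def[symmetric])
  next
    case (3 t)
    have "(c + m + 1) div 2 = m + t + 1" using 3 by simp
    then show ?thesis using 3 \<beta> assms(3)
      by (intro second[of "m + t + 1"]) (auto simp: loc_grp_def c2_def m_def[symmetric])
  qed
qed

lemma loc_c1:
  assumes "\<alpha> \<le> \<beta>" "\<beta> < 2 * \<alpha>" "2 * \<alpha> - \<beta> < i" "i \<le> \<alpha>"
  shows "c1 \<alpha> \<beta> i \<in> {1..\<beta>}" "2 * \<alpha> - \<beta> < c1 \<alpha> \<beta> i" "odd (c1 \<alpha> \<beta> i - (2 * \<alpha> - \<beta>))"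
    "loc_grp \<alpha> \<beta> (c1 \<alpha> \<beta> i) = i"
proof -
  define m where "m = 2 * \<alpha> - \<beta>"
  obtain t where t: "i = m + t + 1" using assms(3) by (metis m_def less_iff_Suc_add add_Suc_right Suc_eq_plus1)
  have \<beta>: "\<beta> = 2 * \<alpha> - m" "m \<le> \<alpha>" "0 < m" using assms by (auto simp: m_def)
  have c: "c1 \<alpha> \<beta> i = m + 2 * t + 1" using \<beta> t assms by (auto simp: c1_def)
  show "c1 \<alpha> \<beta> i \<in> {1..\<beta>}" "2 * \<alpha> - \<beta> < c1 \<alpha> \<beta> i" "odd (c1 \<alpha> \<beta> i - (2 * \<alpha> - \<beta>))"
    "loc_grp \<alpha> \<beta> (c1 \<alpha> \<beta> i) = i"
    using \<beta> t assms(4) unfolding c m_def[symmetric] by (auto simp: loc_grp_def m_def[symmetric])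
qed

lemma loc_c2:
  assumes "\<alpha> \<le> \<beta>" "\<beta> < 2 * \<alpha>" "2 * \<alpha> - \<beta> < i" "i \<le> \<alpha>"
  shows "c2 \<alpha> \<beta> i \<in> {1..\<beta>}" "2 * \<alpha> - \<beta> < c2 \<alpha> \<beta> i" "even (c2 \<alpha> \<beta> i - (2 * \<alpha> - \<beta>))"
    "loc_grp \<alpha> \<beta> (c2 \<alpha> \<beta> i) = i"
proof -
  define m where "m = 2 * \<alpha> - \<beta>"
  obtain t where t: "i = m + t + 1" using assms(3) by (metis m_def less_iff_Suc_add add_Suc_right Suc_eq_plus1)
  have \<beta>: "\<beta> = 2 * \<alpha> - m" "m \<le> \<alpha>" "0 < m" using assms by (auto simp: m_def)
  have c: "c2 \<alpha> \<beta> i = m + 2 * t + 2" using \<beta> t assms by (auto simp: c2_def)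
  show "c2 \<alpha> \<beta> i \<in> {1..\<beta>}" "2 * \<alpha> - \<beta> < c2 \<alpha> \<beta> i" "even (c2 \<alpha> \<beta> i - (2 * \<alpha> - \<beta>))"
    "loc_grp \<alpha> \<beta> (c2 \<alpha> \<beta> i) = i"
    using \<beta> t assms(4) unfolding c m_def[symmetric] by (auto simp: loc_grp_def m_def[symmetric])
qed

lemma loc_grp_single: "c \<le> 2 * \<alpha> - \<beta> \<Longrightarrow> loc_grp \<alpha> \<beta> c = c"
  by (simp add: loc_grp_def)

lemma loc_grp_range:
  assumes "\<alpha> \<le> \<beta>" "\<beta> < 2 * \<alpha>" "c \<in> {1..\<beta>}"
  shows "loc_grp \<alpha> \<beta> c \<in> {1..\<alpha>}"
  by (rule loc_column_cases[OF assms]) (use assms in auto)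

lemma loc_cpl_grp:
  assumes "\<alpha> \<le> \<beta>" "\<beta> < 2 * \<alpha>" "c \<in> {1..\<beta>}" "i \<in> {1..\<alpha>}" "c' \<in> loc_cpl \<alpha> \<beta> i c"
  shows "c' \<in> {1..\<beta>} \<and> loc_grp \<alpha> \<beta> c' = i"
  using assms loc_c1[OF assms(1,2), of i] loc_c2[OF assms(1,2), of i] loc_grp_single[of i \<alpha> \<beta>]
  by (auto simp: loc_cpl_def Let_def split: if_splits)

text \<open>Two partners arise only for a column up to \<open>m\<close> and a row beyond it. The
  clause \<open>\<alpha> < \<beta>\<close> is carried along because the counting needs that \<alpha>
  then does not divide \<open>n\<close>.\<close>

lemma loc_cpl_cpl:
  assumes "\<alpha> \<le> \<beta>" "\<beta> < 2 * \<alpha>" "c \<in> {1..\<beta>}" "i \<in> {1..\<alpha>}" "loc_grp \<alpha> \<beta> c < i"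
  obtains (one) c' where "loc_cpl \<alpha> \<beta> i c = {c'}" "loc_cpl \<alpha> \<beta> (loc_grp \<alpha> \<beta> c) c' = {c}"
  | (two) c' c'' where "\<alpha> < \<beta>" "c' \<noteq> c''" "loc_cpl \<alpha> \<beta> i c = {c', c''}"
      "loc_cpl \<alpha> \<beta> (loc_grp \<alpha> \<beta> c) c' = {c}" "loc_cpl \<alpha> \<beta> (loc_grp \<alpha> \<beta> c) c'' = {}"
proof -
  define m where "m = 2 * \<alpha> - \<beta>"
  note c1 = loc_c1[OF assms(1,2), folded m_def] and c2 = loc_c2[OF assms(1,2), folded m_def]
  note cpl = loc_cpl_def[of \<alpha> \<beta>, folded m_def]
  have i: "i \<le> \<alpha>" using assms(4) by simp
  show ?thesis
  proof (cases rule: loc_column_cases[OF assms(1-3), folded m_def, case_names single first second])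
    case single
    show ?thesis
    proof (cases "i \<le> m")
      case True
      then show ?thesis using single by (intro one[of i]) (auto simp: cpl)
    next
      case False
      then have "m < i" by simp
      show ?thesis
      proof (rule two[of "c1 \<alpha> \<beta> i" "c2 \<alpha> \<beta> i"])
        show "\<alpha> < \<beta>" using \<open>m < i\<close> i by (auto simp: m_def)
        show "c1 \<alpha> \<beta> i \<noteq> c2 \<alpha> \<beta> i" using c1(3)[OF \<open>m < i\<close> i] c2(3)[OF \<open>m < i\<close> i] by auto
      qed (use single \<open>m < i\<close> c1[OF \<open>m < i\<close> i] c2[OF \<open>m < i\<close> i] in \<open>auto simp: cpl\<close>)
    qed
  next
    case (first j)
    then have "m < i" using assms(5) by simp
    then show ?thesis using first c1[OF \<open>m < i\<close> i] by (intro one[of "c1 \<alpha> \<beta> i"]) (auto simp: cpl)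
  next
    case (second j)
    then have "m < i" using assms(5) by simp
    then show ?thesis using second c2[OF \<open>m < i\<close> i] by (intro one[of "c2 \<alpha> \<beta> i"]) (auto simp: cpl)
  qed
qed

lemma set_transform_eq:
  assumes "\<alpha> \<le> \<beta>" "\<beta> < 2 * \<alpha>" "c \<in> {1..\<beta>}" "i \<in> {1..\<alpha>}"
  shows "set_transform \<alpha> \<beta> \<theta> b i c = b i c
    + (if i < loc_grp \<alpha> \<beta> c then 1 else if i = loc_grp \<alpha> \<beta> c then 0 else \<theta> i c)
      * (\<Sum>c'\<in>loc_cpl \<alpha> \<beta> i c. b (loc_grp \<alpha> \<beta> c) c')"
proof -
  define m where "m = 2 * \<alpha> - \<beta>"
  have i: "i \<le> \<alpha>" "1 \<le> i" using assms(4) by auto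
  show ?thesis
  proof (cases rule: loc_column_cases[OF assms(1-3), folded m_def, case_names single first second])
    case single
    \<comment> \<open>Distinctness, seen from the parity of the offsets, ensures that the sum over
      the two-element coupling set really has both terms.\<close>
    have "c1 \<alpha> \<beta> i \<noteq> c2 \<alpha> \<beta> i" if "m < i"
      using loc_c1(3)[OF assms(1,2)] loc_c2(3)[OF assms(1,2)] that i by (metis m_def)
    then show ?thesis using single i assms(3)
      by (auto simp: set_transform_def loc_cpl_def Let_def m_def[symmetric])
  next
    case (first j)
    then have "(c + m + 1) div 2 = j" by (simp add: loc_grp_def Let_def m_def[symmetric])
    then show ?thesis using first i assms(3)
      by (auto simp: set_transform_def loc_cpl_def Let_def m_def[symmetric])
  next
    case (second j)
    then have "(c + m + 1) div 2 = j" by (simp add: loc_grp_def Let_def m_def[symmetric])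
    then show ?thesis using second i assms(3)
      by (auto simp: set_transform_def loc_cpl_def Let_def m_def[symmetric])
  qed
qed

section \<open>Positions of columns inside their blocks\<close>

lemma block_bounds:
  assumes "0 < \<alpha>" "\<alpha> \<le> n" "J \<in> {1..n}"
  shows "block_of n \<alpha> J * \<alpha> < J" "J \<le> block_of n \<alpha> J * \<alpha> + block_width n \<alpha> (block_of n \<alpha> J)"
    "block_of n \<alpha> J < n div \<alpha>"
proof -
  define L where "L = n div \<alpha>"
  have L: "1 \<le> L" using assms by (simp add: L_def Suc_le_eq div_greater_zero_iff)
  define l where "l = block_of n \<alpha> J"
  have l: "l \<le> (J - 1) div \<alpha>" "l \<le> L - 1" by (auto simp: l_def block_of_def L_def)
  have "l * \<alpha> \<le> (J - 1) div \<alpha> * \<alpha>" using l by simp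
  also have "\<dots> \<le> J - 1" by simp
  finally show 1: "block_of n \<alpha> J * \<alpha> < J" using assms by (auto simp: l_def)
  show "J \<le> block_of n \<alpha> J * \<alpha> + block_width n \<alpha> (block_of n \<alpha> J)"
  proof (cases "l = L - 1")
    case True
    then show ?thesis using 1 assms(3) by (simp add: block_width_def l_def[symmetric] L_def[symmetric])
  next
    case False
    then have "l = (J - 1) div \<alpha>" using l by (auto simp: l_def block_of_def L_def min_def split: if_splits)
    moreover have "J - 1 < ((J - 1) div \<alpha> + 1) * \<alpha>" using assms(1) by (simp add: dividend_less_div_times)
    ultimately have "J - 1 < l * \<alpha> + \<alpha>" by simp
    then show ?thesis using False by (simp add: block_width_def l_def[symmetric] L_def[symmetric])
  qed
  show "block_of n \<alpha> J < n div \<alpha>" using l L by (auto simp: l_def L_def)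
qed

lemma block_width_last:
  assumes "0 < \<alpha>" "\<alpha> \<le> n"
  shows "block_width n \<alpha> (n div \<alpha> - 1) = \<alpha> + n mod \<alpha>"
proof -
  obtain d where d: "n div \<alpha> = Suc d" using assms by (metis div_greater_zero_iff gr0_conv_Suc)
  have "n = n div \<alpha> * \<alpha> + n mod \<alpha>" by simp
  then have "n = d * \<alpha> + \<alpha> + n mod \<alpha>" unfolding d by simp
  then have "n - d * \<alpha> = \<alpha> + n mod \<alpha>" by linarith
  then show ?thesis using d by (simp add: block_width_def)
qed

lemma block_width_range:
  assumes "0 < \<alpha>" "\<alpha> \<le> n"
  shows "\<alpha> \<le> block_width n \<alpha> l" "block_width n \<alpha> l < 2 * \<alpha>"
proof -
  have "block_width n \<alpha> l = \<alpha> \<or> block_width n \<alpha> l = \<alpha> + n mod \<alpha>"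
    using block_width_last[OF assms] by (cases "l = n div \<alpha> - 1") (simp_all add: block_width_def)
  moreover have "n mod \<alpha> < \<alpha>" using assms by simp
  ultimately show "\<alpha> \<le> block_width n \<alpha> l" "block_width n \<alpha> l < 2 * \<alpha>" using assms by linarith+
qed

lemma block_of_column:
  assumes "0 < \<alpha>" "\<alpha> \<le> n" "l < n div \<alpha>" "c \<in> {1..block_width n \<alpha> l}"
  shows "block_of n \<alpha> (l * \<alpha> + c) = l" "l * \<alpha> + c \<in> {1..n}"
proof -
  have n: "n div \<alpha> * \<alpha> \<le> n" by simp
  have "l * \<alpha> + \<alpha> \<le> n" using assms(3) n by (metis Suc_leI add.commute mult_Suc mult_le_mono1 order.trans)
  then have "block_width n \<alpha> l \<le> n - l * \<alpha>" by (auto simp: block_width_def)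
  then show "l * \<alpha> + c \<in> {1..n}" using assms(4) \<open>l * \<alpha> + \<alpha> \<le> n\<close> by auto
  show "block_of n \<alpha> (l * \<alpha> + c) = l"
  proof (cases "l = n div \<alpha> - 1")
    case True
    have "l * \<alpha> \<le> l * \<alpha> + c - 1" using assms(4) by auto
    then have "l \<le> (l * \<alpha> + c - 1) div \<alpha>"
      using assms(1) div_le_mono[of "l * \<alpha>" _ \<alpha>] by simp
    then show ?thesis using True by (simp add: block_of_def)
  next
    case False
    then have "c - 1 < \<alpha>" "c \<ge> 1" using assms by (auto simp: block_width_def)
    then have "(l * \<alpha> + c - 1) div \<alpha> = l"
      using assms(1) by (metis add_diff_assoc div_less div_mult_self3 add_0_right less_numeral_extra(3))
    then show ?thesis using False assms(3) by (simp add: block_of_def)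
  qed
qed

section \<open>The code ST-RS\<close>

definition st_grp :: "nat \<Rightarrow> nat \<Rightarrow> nat \<Rightarrow> nat" where
  "st_grp n \<alpha> J = (let l = block_of n \<alpha> J in loc_grp \<alpha> (block_width n \<alpha> l) (J - l * \<alpha>))"

definition st_cpl :: "nat \<Rightarrow> nat \<Rightarrow> nat \<Rightarrow> nat \<Rightarrow> nat set" where
  "st_cpl n \<alpha> i J = (let l = block_of n \<alpha> J in
     (+) (l * \<alpha>) ` loc_cpl \<alpha> (block_width n \<alpha> l) i (J - l * \<alpha>))"

lemma st_column_cases:
  assumes "0 < \<alpha>" "\<alpha> \<le> n" "J \<in> {1..n}"
  obtains l c where "J = l * \<alpha> + c" "l < n div \<alpha>" "c \<in> {1..block_width n \<alpha> l}" "block_of n \<alpha> J = l"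
    "\<alpha> \<le> block_width n \<alpha> l" "block_width n \<alpha> l < 2 * \<alpha>"
    "st_grp n \<alpha> J = loc_grp \<alpha> (block_width n \<alpha> l) c"
    "\<And>i. st_cpl n \<alpha> i J = (+) (l * \<alpha>) ` loc_cpl \<alpha> (block_width n \<alpha> l) i c"
proof
  let ?l = "block_of n \<alpha> J" and ?c = "J - block_of n \<alpha> J * \<alpha>"
  note b = block_bounds[OF assms]
  show "J = ?l * \<alpha> + ?c" "?l < n div \<alpha>" "?c \<in> {1..block_width n \<alpha> ?l}"
    using b by auto
  show "st_grp n \<alpha> J = loc_grp \<alpha> (block_width n \<alpha> ?l) ?c"
    "\<And>i. st_cpl n \<alpha> i J = (+) (?l * \<alpha>) ` loc_cpl \<alpha> (block_width n \<alpha> ?l) i ?c"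
    by (simp_all add: st_grp_def st_cpl_def Let_def)
qed (use block_width_range[OF assms(1,2)] in auto)

lemma st_column:
  assumes "0 < \<alpha>" "\<alpha> \<le> n" "l < n div \<alpha>" "c \<in> {1..block_width n \<alpha> l}"
  shows "st_grp n \<alpha> (l * \<alpha> + c) = loc_grp \<alpha> (block_width n \<alpha> l) c"
    "st_cpl n \<alpha> i (l * \<alpha> + c) = (+) (l * \<alpha>) ` loc_cpl \<alpha> (block_width n \<alpha> l) i c"
  using block_of_column[OF assms] by (simp_all add: st_grp_def st_cpl_def)

lemma st_grp_range:
  assumes "0 < \<alpha>" "\<alpha> \<le> n" "J \<in> {1..n}"
  shows "st_grp n \<alpha> J \<in> {1..\<alpha>}"
proof (rule st_column_cases[OF assms])
  fix l c assume "c \<in> {1..block_width n \<alpha> l}" "\<alpha> \<le> block_width n \<alpha> l" "block_width n \<alpha> l < 2 * \<alpha>"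
    "st_grp n \<alpha> J = loc_grp \<alpha> (block_width n \<alpha> l) c"
  then show ?thesis using loc_grp_range by simp
qed

lemma st_cpl_grp:
  assumes "0 < \<alpha>" "\<alpha> \<le> n" "J \<in> {1..n}" "i \<in> {1..\<alpha>}" "J' \<in> st_cpl n \<alpha> i J"
  shows "J' \<in> {1..n} \<and> st_grp n \<alpha> J' = i"
proof (rule st_column_cases[OF assms(1-3)])
  fix l c assume *: "J = l * \<alpha> + c" "l < n div \<alpha>" "c \<in> {1..block_width n \<alpha> l}"
    "\<alpha> \<le> block_width n \<alpha> l" "block_width n \<alpha> l < 2 * \<alpha>"
    "\<And>i. st_cpl n \<alpha> i J = (+) (l * \<alpha>) ` loc_cpl \<alpha> (block_width n \<alpha> l) i c"
  obtain c' where c': "c' \<in> loc_cpl \<alpha> (block_width n \<alpha> l) i c" "J' = l * \<alpha> + c'"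
    using assms(5) *(6) by auto
  have "c' \<in> {1..block_width n \<alpha> l}" "loc_grp \<alpha> (block_width n \<alpha> l) c' = i"
    using loc_cpl_grp[OF *(4,5,3) assms(4) c'(1)] by auto
  then show ?thesis
    using st_column(1)[OF assms(1,2) *(2)] block_of_column(2)[OF assms(1,2) *(2)] c'(2) by auto
qed

lemma st_cpl_cpl:
  assumes "0 < \<alpha>" "\<alpha> \<le> n" "J \<in> {1..n}" "i \<in> {1..\<alpha>}" "st_grp n \<alpha> J < i"
  obtains (one) J' where "st_cpl n \<alpha> i J = {J'}" "st_cpl n \<alpha> (st_grp n \<alpha> J) J' = {J}"
  | (two) J' J'' where "n mod \<alpha> \<noteq> 0" "J' \<noteq> J''" "st_cpl n \<alpha> i J = {J', J''}"
      "st_cpl n \<alpha> (st_grp n \<alpha> J) J' = {J}" "st_cpl n \<alpha> (st_grp n \<alpha> J) J'' = {}"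
proof (rule st_column_cases[OF assms(1-3)])
  fix l c assume *: "J = l * \<alpha> + c" "l < n div \<alpha>" "c \<in> {1..block_width n \<alpha> l}"
    "\<alpha> \<le> block_width n \<alpha> l" "block_width n \<alpha> l < 2 * \<alpha>"
    "st_grp n \<alpha> J = loc_grp \<alpha> (block_width n \<alpha> l) c"
    "\<And>i. st_cpl n \<alpha> i J = (+) (l * \<alpha>) ` loc_cpl \<alpha> (block_width n \<alpha> l) i c"
  let ?w = "block_width n \<alpha> l"
  have in_range: "c' \<in> {1..?w}" if "c' \<in> loc_cpl \<alpha> ?w i c" for c'
    using loc_cpl_grp[OF *(4,5,3) assms(4) that] by blast
  have cpl: "st_cpl n \<alpha> g (l * \<alpha> + c') = (+) (l * \<alpha>) ` loc_cpl \<alpha> ?w g c'"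
    if "c' \<in> loc_cpl \<alpha> ?w i c" for g c'
    using st_column(2)[OF assms(1,2) *(2) in_range[OF that]] .
  have lt: "loc_grp \<alpha> ?w c < i" using assms(5) *(6) by simp
  show thesis
  proof (cases rule: loc_cpl_cpl[OF *(4,5,3) assms(4) lt, case_names one' two'])
    case (one' c')
    then show thesis using * cpl[of c'] by (intro one[of "l * \<alpha> + c'"]) auto
  next
    case (two' c' c'')
    \<comment> \<open>Only the last block can be wider than \<alpha>, and its excess is
      \<open>n mod \<alpha>\<close>.\<close>
    have "n mod \<alpha> \<noteq> 0"
      using two'(1) block_width_last[OF assms(1,2)] by (auto simp: block_width_def split: if_splits)
    then show thesis using two' * cpl[of c'] cpl[of c'']
      by (intro two[of "l * \<alpha> + c'" "l * \<alpha> + c''"]) auto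
  qed
qed

lemma coupled_array_st:
  assumes "0 < \<alpha>" "\<alpha> \<le> n" "k \<le> n" "inj_on x {1..n}"
  shows "coupled_array n k \<alpha> (x :: nat \<Rightarrow> 'a::{finite,field}) (st_grp n \<alpha>) (st_cpl n \<alpha>)"
proof
  fix J i and \<phi> :: "nat \<Rightarrow> 'a"
  assume *: "J \<in> {1..n}" "i \<in> {1..\<alpha>}" "st_grp n \<alpha> J < i"
  show "(\<Sum>J'\<in>st_cpl n \<alpha> i J. \<Sum>J''\<in>st_cpl n \<alpha> (st_grp n \<alpha> J) J'. \<phi> J'') = \<phi> J"
    by (cases rule: st_cpl_cpl[OF assms(1,2) *]) auto
qed (fact assms, fact assms, erule st_grp_range[OF assms(1,2)], rule st_cpl_grp[OF assms(1,2)])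

text \<open>The rounded-up quotients are recorded by the inequalities that pin them down, and the
  bound on the field size is written additively, so that neither reals nor a truncated difference of
  binomials occurs later.\<close>

locale st_code =
  fixes n k \<alpha> :: nat and x :: "nat \<Rightarrow> 'a::{finite,field}" and N K :: nat
  assumes k_pos: "1 \<le> k" and alpha_ge: "2 \<le> \<alpha>" and n_ge: "k + \<alpha> \<le> n" and inj_x: "inj_on x {1..n}"
    and N: "\<alpha> * (N - 1) < n" "n \<le> \<alpha> * N" and K: "\<alpha> * (K - 1) < k" "k \<le> \<alpha> * K" "1 \<le> K"
    and card_bound: "((n - 1) choose (k - 1)) < card (UNIV :: 'a set) + ((N - 1) choose (K - 1))"
begin

sublocale coupled_array n k \<alpha> x "st_grp n \<alpha>" "st_cpl n \<alpha>"
  using coupled_array_st[of \<alpha> n k x] k_pos alpha_ge n_ge inj_x by simp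

lemma alpha_pos: "0 < \<alpha>" "\<alpha> \<le> n"
  using alpha_ge n_ge by auto

lemma n_le_card: "n \<le> card (UNIV :: 'a set)"
  using card_mono[of UNIV "x ` {1..n}"] card_image[OF inj_x] by simp

lemma st_rs_eq_symbol:
  assumes "i \<in> {1..\<alpha>}" "J \<in> {1..n}"
    and \<theta>: "\<And>l c. l * \<alpha> + c = J \<Longrightarrow> (i, J) \<in> positions \<Longrightarrow> \<theta> l i c = \<tau> (i, J)"
  shows "st_rs n k \<alpha> x \<theta> a i J = symbol \<tau> a i J"
proof (rule st_column_cases[OF alpha_pos assms(2)])
  fix l c assume *: "J = l * \<alpha> + c" "l < n div \<alpha>" "c \<in> {1..block_width n \<alpha> l}" "block_of n \<alpha> J = l"
    "\<alpha> \<le> block_width n \<alpha> l" "block_width n \<alpha> l < 2 * \<alpha>"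
    "st_grp n \<alpha> J = loc_grp \<alpha> (block_width n \<alpha> l) c"
    "\<And>i. st_cpl n \<alpha> i J = (+) (l * \<alpha>) ` loc_cpl \<alpha> (block_width n \<alpha> l) i c"
  let ?w = "block_width n \<alpha> l"
  have "st_rs n k \<alpha> x \<theta> a i J = set_transform \<alpha> ?w (\<theta> l) (\<lambda>i' c. base_array x k a i' (l * \<alpha> + c)) i c"
    using *(1,4) by (simp add: st_rs_def Let_def)
  also have "\<dots> = base_array x k a i (l * \<alpha> + c)
    + (if i < loc_grp \<alpha> ?w c then 1 else if i = loc_grp \<alpha> ?w c then 0 else \<theta> l i c)
      * (\<Sum>c'\<in>loc_cpl \<alpha> ?w i c. base_array x k a (loc_grp \<alpha> ?w c) (l * \<alpha> + c'))"
    by (rule set_transform_eq[OF *(5,6,3) assms(1)])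
  also have "\<dots> = symbol \<tau> a i J"
  proof -
    have "(\<Sum>c'\<in>loc_cpl \<alpha> ?w i c. base_array x k a (loc_grp \<alpha> ?w c) (l * \<alpha> + c')) = partner a i J"
      unfolding partner_def *(7,8) by (subst sum.reindex) (auto simp: inj_on_def)
    moreover have "\<theta> l i c = \<tau> (i, J)" if "loc_grp \<alpha> ?w c < i"
      using \<theta>[of l c] that assms(1,2) *(1,7) by (auto simp: positions_def)
    ultimately show ?thesis using *(1,7) by (auto simp: symbol_def)
  qed
  finally show ?thesis .
qed

lemma mds_if_good:
  assumes "good \<tau>" "\<And>p. p \<in> positions \<Longrightarrow> \<tau> p \<noteq> 0"
  shows "\<exists>\<theta> :: nat \<Rightarrow> nat \<Rightarrow> nat \<Rightarrow> 'a. (\<forall>l i j. \<theta> l i j \<noteq> 0 \<and> \<theta> l i j \<noteq> 1) \<and>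
    is_mds_array_code n k \<alpha> (st_rs n k \<alpha> x \<theta>)"
proof -
  have "3 \<le> n" using k_pos alpha_ge n_ge by linarith
  then have "card {0, 1 :: 'a} < card (UNIV :: 'a set)" using n_le_card by simp
  then have "{0, 1 :: 'a} \<noteq> UNIV" by (metis less_irrefl)
  \<comment> \<open>A default for the indices at which the construction reads no coefficient; these
    must avoid 0 and 1 as well.\<close>
  then obtain u :: 'a where u: "u \<noteq> 0" "u \<noteq> 1" by auto
  define \<theta> where "\<theta> = (\<lambda>l i c. if (i, l * \<alpha> + c) \<in> positions then \<tau> (i, l * \<alpha> + c) else u)"
  have 1: "\<forall>l i j. \<theta> l i j \<noteq> 0 \<and> \<theta> l i j \<noteq> 1"
    using u assms by (auto simp: \<theta>_def good_def)
  have sym: "st_rs n k \<alpha> x \<theta> a i J = symbol \<tau> a i J" if "i \<in> {1..\<alpha>}" "J \<in> {1..n}" for a i J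
    using that by (intro st_rs_eq_symbol) (auto simp: \<theta>_def)
  have "is_mds_array_code n k \<alpha> (st_rs n k \<alpha> x \<theta>)"
    unfolding is_mds_array_code_def
  proof (intro allI impI ballI)
    fix S a a' i s
    assume S: "S \<subseteq> {1..n} \<and> card S = k"
      and eq: "\<forall>i\<in>{1..\<alpha>}. \<forall>j\<in>S. st_rs n k \<alpha> x \<theta> a i j = st_rs n k \<alpha> x \<theta> a' i j"
      and i: "i \<in> {1..\<alpha>}" and s: "s \<in> {1..k}"
    have S': "S \<in> k_sets" using S by (simp add: k_sets_def)
    have "symbol \<tau> (\<lambda>i s. 1 * a i s - 1 * a' i s) i J = 0" if "i \<in> {1..\<alpha>}" "J \<in> S" for i J
      unfolding symbol_lin using sym[of i J] eq that S by fastforce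
    then have "1 * a i s - 1 * a' i s = 0"
      using decodes_all_rows[OF _ S' _ i s, of \<tau>] assms(1) S' unfolding good_def by blast
    then show "a i s = a' i s" by simp
  qed
  then show ?thesis using 1 by blast
qed

lemma card_cpl:
  assumes "(i0, J0) \<in> positions"
  shows "card (st_cpl n \<alpha> i0 J0) = 1 \<or> card (st_cpl n \<alpha> i0 J0) = 2 \<and> n mod \<alpha> \<noteq> 0"
proof -
  have "J0 \<in> {1..n}" "i0 \<in> {1..\<alpha>}" "st_grp n \<alpha> J0 < i0" using assms by (auto simp: positions_def)
  then show ?thesis by (cases rule: st_cpl_cpl[OF alpha_pos]) auto
qed

lemma grp_columns:
  assumes "J \<in> {1..n}" "st_grp n \<alpha> J = i"
  defines "\<beta> \<equiv> \<alpha> + n mod \<alpha>" and "L \<equiv> n div \<alpha>"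
  shows "J \<in> (\<lambda>l. l * \<alpha> + i) ` {..<L - 1} \<or> (i \<le> 2 * \<alpha> - \<beta> \<and> J = (L - 1) * \<alpha> + i)
    \<or> (2 * \<alpha> - \<beta> < i \<and> (J = (L - 1) * \<alpha> + c1 \<alpha> \<beta> i \<or> J = (L - 1) * \<alpha> + c2 \<alpha> \<beta> i))"
proof (rule st_column_cases[OF alpha_pos assms(1)])
  fix l c assume *: "J = l * \<alpha> + c" "l < n div \<alpha>" "c \<in> {1..block_width n \<alpha> l}"
    "\<alpha> \<le> block_width n \<alpha> l" "block_width n \<alpha> l < 2 * \<alpha>"
    "st_grp n \<alpha> J = loc_grp \<alpha> (block_width n \<alpha> l) c"
  show ?thesis
  proof (cases "l = L - 1")
    case True
    then have w: "block_width n \<alpha> l = \<beta>" using block_width_last[OF alpha_pos] by (simp add: \<beta>_def L_def)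
    note ** = *(3-6)[unfolded w]
    show ?thesis
      by (cases rule: loc_column_cases[OF **(2,3,1)]) (use *(1) **(4) True assms(2) in auto)
  next
    case False
    then have "block_width n \<alpha> l = \<alpha>" by (simp add: block_width_def L_def)
    then have "c = i" using *(3,6) assms(2) by (simp add: loc_grp_def)
    then show ?thesis using * False by (auto simp: L_def)
  qed
qed

lemma card_active_group:
  assumes "2 \<le> i" "i \<le> \<alpha>"
  defines "G \<equiv> {J \<in> {1..n}. st_grp n \<alpha> J = i \<and> active J}"
  shows "card G \<le> n div \<alpha> + 1" and "\<alpha> = 2 \<longrightarrow> card G \<le> n div 2"
proof -
  define \<beta> L where "\<beta> = \<alpha> + n mod \<alpha>" and "L = n div \<alpha>"
  have L1: "1 \<le> L" using alpha_pos by (simp add: L_def Suc_le_eq div_greater_zero_iff)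
  let ?A = "(\<lambda>l. l * \<alpha> + i) ` {..<L - 1}"
  have cA: "card ?A \<le> L - 1" using card_image_le[of "{..<L - 1}" "\<lambda>l. l * \<alpha> + i"] by simp
  have "\<exists>B. G \<subseteq> ?A \<union> B \<and> finite B \<and> card B \<le> 2 \<and> (\<alpha> = 2 \<longrightarrow> card B \<le> 1)"
  proof (cases "i \<le> 2 * \<alpha> - \<beta>")
    case True
    then have "G \<subseteq> ?A \<union> {(L - 1) * \<alpha> + i}" using grp_columns by (fastforce simp: G_def \<beta>_def L_def)
    then show ?thesis by (intro exI[of _ "{(L - 1) * \<alpha> + i}"]) auto
  next
    case False
    let ?c1 = "(L - 1) * \<alpha> + c1 \<alpha> \<beta> i" and ?c2 = "(L - 1) * \<alpha> + c2 \<alpha> \<beta> i"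
    have G2: "G \<subseteq> ?A \<union> {?c1, ?c2}" using grp_columns False by (fastforce simp: G_def \<beta>_def L_def)
    show ?thesis
    proof (cases "\<alpha> = 2")
      case True
      then have i: "i = 2" using assms by simp
      have \<beta>3: "\<beta> = 3" using False True i unfolding \<beta>_def by auto
      \<comment> \<open>For \<alpha> = 2 and odd \<open>n\<close> the only other row is row 1, which
        the last column does not enter. This saves one column in \<open>G\<close> and yields the
        sharper bound.\<close>
      have "?c2 \<notin> G"
      proof
        assume "?c2 \<in> G"
        then have "active ?c2" "st_grp n \<alpha> ?c2 = 2" by (auto simp: G_def i)
        then obtain i' where "i' \<in> {1..\<alpha>}" "i' \<noteq> 2" and ne: "st_cpl n \<alpha> i' ?c2 \<noteq> {}"
          unfolding active_def by metis
        then have i': "i' = 1" using True by auto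
        have w: "block_width n \<alpha> (L - 1) = \<beta>" using block_width_last[OF alpha_pos] by (simp add: \<beta>_def L_def)
        have "c2 \<alpha> \<beta> i = 3" by (simp add: c2_def True \<beta>3 i)
        then have "st_cpl n \<alpha> 1 ?c2 = (+) ((L - 1) * \<alpha>) ` loc_cpl \<alpha> \<beta> 1 3"
          using st_column(2)[OF alpha_pos, of "L - 1" 3 1] w \<beta>3 L1 by (simp add: L_def)
        also have "loc_cpl \<alpha> \<beta> 1 3 = {}" by (simp add: loc_cpl_def \<beta>3 True)
        finally show False using ne i' by simp
      qed
      then have "G \<subseteq> ?A \<union> {?c1}" using G2 by auto
      then show ?thesis by (intro exI[of _ "{?c1}"]) auto
    next
      case False
      then show ?thesis using G2 by (intro exI[of _ "{?c1, ?c2}"]) (auto simp: card_insert_if)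
    qed
  qed
  then obtain B where B: "G \<subseteq> ?A \<union> B" "finite B" "card B \<le> 2" "\<alpha> = 2 \<longrightarrow> card B \<le> 1" by blast
  have "card G \<le> card (?A \<union> B)" using B by (intro card_mono) auto
  also have "\<dots> \<le> card ?A + card B" by (rule card_Un_le)
  finally have cG: "card G \<le> L - 1 + card B" using cA by linarith
  show "card G \<le> n div \<alpha> + 1" using cG B(3) L1 unfolding L_def[symmetric] by linarith
  show "\<alpha> = 2 \<longrightarrow> card G \<le> n div 2"
  proof
    assume "\<alpha> = 2"
    then show "card G \<le> n div 2" using cG B(4) L1 unfolding L_def by auto
  qed
qed

lemma safe_count_generic:
  assumes "good \<tau>" "(i0, J0) \<in> positions"
    and "\<not> (\<alpha> = 2 \<and> k = 3 \<and> card (st_cpl n \<alpha> i0 J0) = 2 \<and> (n = 5 \<or> n = 7))"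
  shows "card {S \<in> k_sets. snd (i0, J0) \<in> S} + 2 < card (UNIV :: 'a set) + card (safe \<tau> (i0, J0))"
proof -
  have pos: "J0 \<in> {1..n}" "i0 \<in> {1..\<alpha>}" "st_grp n \<alpha> J0 < i0" using assms(2) by (auto simp: positions_def)
  have i0: "2 \<le> i0" "i0 \<le> \<alpha>" using pos grp_range[OF pos(1)] by auto
  note F = card_safe_families[OF assms(1,2) k_pos refl refl]
  have "finite (safe \<tau> (i0, J0))" using finite_k_sets by (rule rev_finite_subset) (auto simp: safe_def)
  from card_mono[OF this F(1)] show ?thesis
    using counting_bound[OF k_pos alpha_ge n_ge n_le_card N K card_bound card_cpl[OF assms(2)]
        card_active_group[OF i0] assms(3)]
      card_k_sets_containing[OF pos(1) k_pos] unfolding F(2) by (simp only: snd_conv)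
qed

end

section \<open>Small parameters\<close>

lemma st_columns_5:
  "st_grp 5 2 1 = 1" "st_grp 5 2 2 = 2" "st_grp 5 2 3 = 1" "st_grp 5 2 4 = 2" "st_grp 5 2 5 = 2"
  "st_cpl 5 2 2 1 = {2}" "st_cpl 5 2 1 2 = {1}" "st_cpl 5 2 2 3 = {4, 5}" "st_cpl 5 2 1 4 = {3}" "st_cpl 5 2 1 5 = {}"
  by (simp_all add: st_grp_def st_cpl_def block_of_def block_width_def loc_grp_def loc_cpl_def c1_def c2_def)
lemma st_columns_7:
  "st_grp 7 2 1 = 1" "st_grp 7 2 2 = 2" "st_grp 7 2 3 = 1" "st_grp 7 2 4 = 2" "st_grp 7 2 5 = 1" "st_grp 7 2 6 = 2" "st_grp 7 2 7 = 2"
  "st_cpl 7 2 2 1 = {2}" "st_cpl 7 2 1 2 = {1}" "st_cpl 7 2 2 3 = {4}" "st_cpl 7 2 2 5 = {6, 7}"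
  by (simp_all add: st_grp_def st_cpl_def block_of_def block_width_def loc_grp_def loc_cpl_def c1_def c2_def)

lemmas st_columns_small = st_columns_5[unfolded One_nat_def] st_columns_7[unfolded One_nat_def]

context st_code begin

text \<open>Columns 1 and 2 hold a coupled pair that separates because its coefficient is not 1. Row
  1 is also stored plainly in column \<open>J\<close>, so three of its values are known and it
  vanishes; row 2 is then uncoupled. The coefficient at \<open>(2, J)\<close> is never
  consulted.\<close>

lemma decodes_pair:
  assumes \<alpha>: "\<alpha> = 2" and "k = 3" and J: "J \<in> {3..n}" "st_grp n \<alpha> J = 1"
    and grp: "st_grp n \<alpha> 1 = 1" "st_grp n \<alpha> 2 = 2"
    and cpl: "st_cpl n \<alpha> 2 1 = {2}" "st_cpl n \<alpha> 1 2 = {1}"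
    and \<tau>: "\<tau> (2, 1) \<noteq> 1"
  shows "decodes \<tau> {1, 2, J}"
  unfolding decodes_def
proof (intro allI impI)
  let ?S = "{1, 2, J}"
  have S: "?S \<in> k_sets" using assms(2) J(1) unfolding k_sets_def by auto
  have "active 1" unfolding active_def using \<alpha> grp(1) cpl(1) by (intro bexI[of _ 2]) simp_all
  moreover have "active 2" unfolding active_def using \<alpha> grp(2) cpl(2) by (intro bexI[of _ 1]) simp_all
  ultimately have "st_grp n \<alpha> 1 \<in> rows ?S" "st_grp n \<alpha> 2 \<in> rows ?S" unfolding rows_def by blast+
  then have "1 \<in> rows ?S" "2 \<in> rows ?S" using grp by simp_all
  moreover have "rows ?S \<subseteq> {1, 2}" using rows_range[OF S] \<alpha> by fastforce
  ultimately have rows: "rows ?S = {1, 2}" by auto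
  fix a assume *: "\<forall>i\<in>rows ?S. \<forall>J\<in>?S. symbol \<tau> a i J = 0"
  let ?b = "base_array x k a"
  have eq: "?b 1 1 = 0" "?b 1 J = 0" "?b 1 2 + ?b 2 1 = 0" "?b 2 1 + \<tau> (2, 1) * ?b 1 2 = 0"
    using * rows grp cpl J(2) by (auto simp: symbol_def partner_def)
  have "(\<tau> (2, 1) - 1) * ?b 1 2 = (?b 2 1 + \<tau> (2, 1) * ?b 1 2) - (?b 1 2 + ?b 2 1)"
    by (simp add: algebra_simps)
  also have "\<dots> = 0" unfolding eq(3,4) by simp
  finally have "?b 1 2 = 0" using \<tau> by simp
  then have a1: "a 1 s = 0" if "s \<in> {1..k}" for s
    using base_array_inj[OF S _ that, of a 1] eq by auto
  have "?b 2 J' = 0" if "J' \<in> ?S" for J'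
  proof -
    have "symbol \<tau> a 2 J' = ?b 2 J'"
    proof (cases "J' = 2")
      case True
      then show ?thesis using grp by (simp add: symbol_def)
    next
      case False
      then have "st_grp n \<alpha> J' = 1" using that grp J by auto
      then show ?thesis using a1 \<alpha> by (intro symbol_eq_base) auto
    qed
    then show ?thesis using * rows that by auto
  qed
  then have "a 2 s = 0" if "s \<in> {1..k}" for s
    using base_array_inj[OF S _ that, of a 2] by blast
  then show "\<forall>i\<in>rows ?S. \<forall>s\<in>{1..k}. a i s = 0" using a1 rows by auto
qed

text \<open>This is the additional safe set for the exceptional parameters. Its decoding depends on
  the coefficient at \<open>(2, 1)\<close>, which differs from 1 because \<open>good\<close> keeps
  track of this.\<close>

lemma safe_pair:
  assumes "good \<tau>" "\<alpha> = 2" "k = 3" "n = 5 \<or> n = 7"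
  shows "{1, 2, n - 2} \<in> safe \<tau> (2, n - 2)"
proof -
  have "decodes (\<tau>((2, n - 2) := t)) {1, 2, n - 2}" if "t \<noteq> 1" for t
    using assms(2-) assms(1)[unfolded good_def] by (intro decodes_pair) (auto simp: st_columns_small)
  then show ?thesis using assms(3,4) unfolding safe_def k_sets_def by auto
qed

lemma positions_small:
  assumes "\<alpha> = 2" "n = 5 \<or> n = 7" "(i0, J0) \<in> positions" "card (st_cpl n \<alpha> i0 J0) = 2"
  shows "i0 = 2" "J0 = n - 2"
proof -
  have pos: "J0 \<in> {1..n}" "i0 \<in> {1..2}" "st_grp n \<alpha> J0 < i0"
    using assms(1,3) unfolding positions_def by auto
  then show "i0 = 2" using grp_range[OF pos(1)] by auto
  then have i0: "i0 = 2" .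
  from assms(2) show "J0 = n - 2"
  proof
    assume n: "n = 5"
    then have "J0 \<in> {1,2,3,4,5}" using pos(1) by auto
    then show ?thesis using pos(3) assms(1,4) n i0 by (auto simp: st_columns_small)
  next
    assume n: "n = 7"
    then have "J0 \<in> {1,2,3,4,5,6,7}" using pos(1) by auto
    then show ?thesis using pos(3) assms(1,4) n i0 by (auto simp: st_columns_small)
  qed
qed

lemma safe_count:
  assumes "good \<tau>" "p \<in> positions"
    and "\<not> (\<alpha> = 2 \<and> k = 3 \<and> n = 5 \<and> card (UNIV :: 'a set) = 5 \<and> p = (2, 3))"
  shows "card {S \<in> k_sets. snd p \<in> S} + 2 < card (UNIV :: 'a set) + card (safe \<tau> p)"
proof -
  obtain i0 J0 where p: "p = (i0, J0)" by (cases p)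
  show ?thesis
  proof (cases "\<alpha> = 2 \<and> k = 3 \<and> card (st_cpl n \<alpha> i0 J0) = 2 \<and> (n = 5 \<or> n = 7)")
    case False
    then show ?thesis using safe_count_generic[OF assms(1), of i0 J0] assms(2) p by simp
  next
    case True
    have ij: "i0 = 2" "J0 = n - 2" using positions_small[of i0 J0] True assms(2) p by auto
    define G where "G = {J \<in> {1..n}. st_grp n \<alpha> J = i0 \<and> active J}"
    define F where "F = {S. insert J0 (st_cpl n \<alpha> i0 J0) \<subseteq> S \<and> S \<subseteq> {1..n} \<and> card S = k}
      \<union> {S. {J0} \<subseteq> S \<and> S \<subseteq> {1..n} - G \<and> card S = k}"
    note F = card_safe_families[OF assms(1) assms(2)[unfolded p] k_pos G_def F_def]
    have g: "card G \<le> n div 2" using card_active_group(2)[of i0] True ij(1) by (simp add: G_def)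
    have 2: "st_cpl n \<alpha> 1 2 = {1}" "st_grp n \<alpha> 2 = 2" using True by (auto simp: st_columns_small)
    have "active 2" unfolding active_def using 2 True by (intro bexI[of _ 1]) simp_all
    then have "2 \<in> G" using 2(2) True ij(1) unfolding G_def by auto
    moreover have "n - 1 \<in> st_cpl n \<alpha> i0 J0" using True ij by (auto simp: st_columns_small)
    \<comment> \<open>The new set contains the active column 2 of row 2 and misses the partner
      \<open>n - 1\<close>, so it lies in neither family.\<close>
    ultimately have notin: "{1, 2, n - 2} \<notin> F" using True unfolding F_def by auto
    have fin: "finite (safe \<tau> p)" using finite_k_sets by (rule rev_finite_subset) (auto simp: safe_def)
    have sub: "insert {1, 2, n - 2} F \<subseteq> safe \<tau> p"
      using F(1) safe_pair[OF assms(1)] True p ij by auto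
    have "card F + 1 \<le> card (safe \<tau> p)"
      using card_mono[OF fin sub] notin finite_subset[OF F(1)] fin p by simp
    moreover have "((n - 1 - n div 2) choose 2) \<le> ((n - 1 - card G) choose 2)"
      using g True by (intro binomial_right_mono) auto
    moreover have "card {S \<in> k_sets. snd p \<in> S} = (n - 1) choose 2"
      using card_k_sets_containing[of J0] True p ij(2) by auto
    \<comment> \<open>The hypothesis now says \<open>q > 4\<close> for \<open>n = 5\<close> and
      \<open>q > 12\<close> for \<open>n = 7\<close>. Three safe sets suffice for
      \<open>q > 5\<close> in the former case, five for \<open>q > 12\<close> in the latter.\<close>
    moreover have "K - 1 = 1" "N - 1 = n div 2" using N K True by auto
    ultimately show ?thesis using F(2) True card_bound n_le_card assms(3) p ij
      by (auto simp: choose_two)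
  qed
qed

end

section \<open>The (5, 3, 2) code over the field with five elements\<close>

lemma of_int_card_5:
  assumes "card (UNIV :: 'a::{finite,field} set) = 5"
  shows "(of_int z :: 'a) = 0 \<longleftrightarrow> 5 dvd z"
    and "\<exists>w\<in>{0,1,2,3,4}. (y :: 'a) = of_int w"
proof -
  \<comment> \<open>Translation by 1 permutes the field, so adding 1 to each of the five summands
    does not change the total: 5 is 0.\<close>
  have "(\<Sum>y\<in>UNIV. y + 1) = (\<Sum>y\<in>(UNIV :: 'a set). y)"
    by (rule sum.reindex_bij_witness[of _ "\<lambda>y. y - 1" "\<lambda>y. y + 1"]) auto
  then have "(of_nat 5 :: 'a) = 0" using assms by (simp add: sum.distrib)
  then have "CHAR('a) dvd 5" by (simp add: of_nat_eq_0_iff_char_dvd del: of_nat_numeral)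
  moreover have "prime (5::nat)" by simp
  moreover have "CHAR('a) \<noteq> 1" by (metis of_nat_CHAR of_nat_1 zero_neq_one)
  ultimately have char: "CHAR('a) = 5" by (metis prime_nat_iff)
  show dvd: "(of_int z :: 'a) = 0 \<longleftrightarrow> 5 dvd z" for z
    by (simp add: of_int_eq_0_iff_char_dvd char)
  have "inj_on (of_int :: int \<Rightarrow> 'a) {0,1,2,3,4}"
  proof (rule inj_onI)
    fix u v :: int assume uv: "u \<in> {0,1,2,3,4}" "v \<in> {0,1,2,3,4}" "(of_int u :: 'a) = of_int v"
    then have "5 dvd u - v" using dvd[of "u - v"] by simp
    then show "u = v" using uv(1,2) by auto
  qed
  then have "card ((of_int :: int \<Rightarrow> 'a) ` {0,1,2,3,4}) = card (UNIV :: 'a set)"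
    using assms by (subst card_image) auto
  then have "(of_int :: int \<Rightarrow> 'a) ` {0,1,2,3,4} = UNIV"
    by (intro card_subset_eq) auto
  then show "\<exists>w\<in>{0,1,2,3,4}. y = of_int w" by blast
qed

definition quadratic :: "('a::field \<Rightarrow> 'a) \<Rightarrow> bool" where
  "quadratic f \<longleftrightarrow> (\<exists>a b c. \<forall>t. f t = a + b * t + c * t ^ 2)"

lemma quadratic_root:
  assumes "quadratic f" "f r = 0"
  obtains p q where "\<And>t. f t = (t - r) * (p + q * t)"
proof -
  obtain a b c where f: "\<And>t. f t = a + b * t + c * t ^ 2" using assms(1) by (auto simp: quadratic_def)
  have "f t = (t - r) * ((b + c * r) + c * t) + f r" for t
    by (simp add: f algebra_simps power2_eq_square)
  then show thesis using that[of "b + c * r" c] assms(2) by simp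
qed

lemma quadratic_two_roots:
  assumes "quadratic f" "f r = 0" "f s = 0" "r \<noteq> s"
  obtains c where "\<And>t. f t = c * (t - r) * (t - s)"
proof -
  obtain p q where f: "\<And>t. f t = (t - r) * (p + q * t)" using quadratic_root[OF assms(1,2)] by metis
  then have "p = - q * s" using assms(3,4) by (simp add: eq_neg_iff_add_eq_0)
  then have "f t = q * (t - r) * (t - s)" for t by (simp add: f algebra_simps)
  then show thesis using that by blast
qed

text \<open>An affine substitution preserves the degree, so the first two evaluation points may be
  moved to 0 and 1. Over five elements this leaves only the orderings of 2, 3, 4 for the other
  three.\<close>

lemma rs_encode_quadratic:
  assumes "x 2 \<noteq> x 1"
  obtains f where "quadratic f" "\<And>j. rs_encode x 3 v j = f ((x j - x 1) / (x 2 - x 1))"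
proof -
  obtain p where p: "degree p < 3" "\<And>j. rs_encode x 3 v j = poly p (x j)"
    using rs_encode_poly[of 3 x v] by auto
  define q where "q = pcompose p [:x 1, x 2 - x 1:]"
  have "degree q \<le> degree p * degree [:x 1, x 2 - x 1:]" unfolding q_def by (rule degree_pcompose_le)
  also have "\<dots> \<le> 2" using p(1) by simp
  finally have "q = [:coeff q 0, coeff q 1, coeff q 2:]"
    by (intro poly_eqI) (auto simp: coeff_pCons coeff_eq_0 numeral_2_eq_2 split: nat.split)
  then have "poly q t = coeff q 0 + coeff q 1 * t + coeff q 2 * t ^ 2" for t
    by (metis (no_types, opaque_lifting) add.assoc distrib_left mult.commute mult.left_commute mult_zero_right
      add.right_neutral poly_0 poly_pCons power2_eq_square)
  then have "quadratic (poly q)" unfolding quadratic_def by blast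
  moreover have "rs_encode x 3 v j = poly q ((x j - x 1) / (x 2 - x 1))" for j
    using assms by (simp add: p(2) q_def poly_pcompose)
  ultimately show thesis by (rule that)
qed

text \<open>The next three lemmas treat the node sets \<open>{1, 3, 4}\<close>, \<open>{2, 3, 4}\<close> and \<open>{2, 3, 5}\<close> of the
  (5, 3, 2) code: the rows are values of the quadratics \<open>f\<close> and \<open>h\<close>, and the evaluation points
  are normalized affinely to \<open>0, 1, y3, y4, y5\<close>.\<close>

lemma quadratics_vanish_134:
  fixes f h :: "'a::field \<Rightarrow> 'a"
  assumes "quadratic f" "quadratic h" "y3 \<noteq> 0" "y4 \<noteq> 0" "y3 \<noteq> y4"
    and "\<eta> * (y4 * (y4 - y3) + y5 * (y5 - y3)) - y4 * (y4 - y3) \<noteq> 0"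
    and eqs: "f 0 = 0" "h 0 = 0" "f y3 = 0" "h y3 + \<eta> * (f y4 + f y5) = 0" "f y4 + h y3 = 0" "h y4 = 0"
  shows "f y4 = 0" "h y3 = 0"
proof -
  \<comment> \<open>Two known roots leave one unknown scalar. The equation containing
    \<open>\<eta>\<close> becomes this scalar times the expression assumed to be nonzero; the same
    plan works for the other two node sets.\<close>
  obtain c where c: "\<And>t. f t = c * (t - 0) * (t - y3)"
    using quadratic_two_roots[OF assms(1) eqs(1,3)] assms(3) by metis
  have h3: "h y3 = - f y4" using eqs(5) by (simp add: eq_neg_iff_add_eq_0 add.commute)
  have "c * (\<eta> * (y4 * (y4 - y3) + y5 * (y5 - y3)) - y4 * (y4 - y3)) = - f y4 + \<eta> * (f y4 + f y5)"
    by (simp add: c algebra_simps)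
  also have "\<dots> = 0" using eqs(4) unfolding h3 .
  finally have "c * (\<eta> * (y4 * (y4 - y3) + y5 * (y5 - y3)) - y4 * (y4 - y3)) = 0" .
  then have "c = 0" using assms(6) by simp
  then show "f y4 = 0" "h y3 = 0" using eqs(5) by (simp_all add: c)
qed

lemma quadratics_vanish_234:
  fixes f h :: "'a::field \<Rightarrow> 'a"
  assumes "quadratic f" "quadratic h" "y3 \<noteq> 1" "y4 \<noteq> 1" "y3 \<noteq> y4"
    and "(1 - \<eta>) * (y3 - 1) ^ 2 * (y3 - y4) * (y4 - 1)
      + \<eta> * (y5 - y3) * (y4 * (y4 - y5) + (y3 - 1) ^ 2 * (y5 - 1)) \<noteq> 0"
    and eqs: "f 1 + h 0 = 0" "h 1 = 0" "f y3 = 0" "h y3 + \<eta> * (f y4 + f y5) = 0" "f y4 + h y3 = 0" "h y4 = 0"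
  shows "f 1 = 0" "f y4 = 0" "h y3 = 0"
proof -
  obtain e where e: "\<And>t. h t = e * (t - 1) * (t - y4)"
    using quadratic_two_roots[OF assms(2) eqs(2,6)] assms(4) by metis
  obtain p q where f: "\<And>t. f t = (t - y3) * (p + q * t)" using quadratic_root[OF assms(1) eqs(3)] by metis
  have g1: "(y3 - 1) * (p + q) = e * y4" using eqs(1) by (simp add: e f algebra_simps)
  have "(y4 - y3) * ((p + q * y4) - e * (y3 - 1)) = 0" using eqs(5) by (simp add: e f algebra_simps)
  then have g4: "p + q * y4 = e * (y3 - 1)" using assms(5) by simp
  \<comment> \<open>The linear factor \<open>p + q * t\<close> is interpolated at \<open>y5\<close>
    from its values at 1 and \<open>y4\<close>, which \<open>g1\<close> and \<open>g4\<close>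
    express through \<open>e\<close>.\<close>
  have "(y3 - 1) * (y4 - 1) * f y5 = (y5 - y3) * ((y4 - y5) * ((y3 - 1) * (p + q)) + (y5 - 1) * (y3 - 1) * (p + q * y4))"
    by (simp add: f algebra_simps)
  also have "\<dots> = e * ((y5 - y3) * (y4 * (y4 - y5) + (y3 - 1) ^ 2 * (y5 - 1)))"
    unfolding g1 g4 by (simp add: algebra_simps power2_eq_square)
  finally have f5: "(y3 - 1) * (y4 - 1) * f y5 = e * ((y5 - y3) * (y4 * (y4 - y5) + (y3 - 1) ^ 2 * (y5 - 1)))" .
  have "f y4 = - h y3" using eqs(5) by (simp add: eq_neg_iff_add_eq_0)
  then have "(1 - \<eta>) * h y3 + \<eta> * f y5 = 0" using eqs(4) by (simp add: algebra_simps)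
  then have "(1 - \<eta>) * ((y3 - 1) * (y4 - 1) * h y3) + \<eta> * ((y3 - 1) * (y4 - 1) * f y5) = 0"
    by (metis (no_types, opaque_lifting) distrib_left mult.left_commute mult_zero_right)
  then have "e * ((1 - \<eta>) * (y3 - 1) ^ 2 * (y3 - y4) * (y4 - 1)
      + \<eta> * (y5 - y3) * (y4 * (y4 - y5) + (y3 - 1) ^ 2 * (y5 - 1))) = 0"
    unfolding f5 e by (simp add: algebra_simps power2_eq_square)
  then have "e = 0" using assms(6) by simp
  then show "f 1 = 0" "f y4 = 0" "h y3 = 0" using eqs(1,5) by (simp_all add: e)
qed

lemma quadratics_vanish_235:
  fixes f h :: "'a::field \<Rightarrow> 'a"
  assumes "quadratic f" "quadratic h" "y3 \<noteq> y5" "y5 \<noteq> 0" "y5 \<noteq> 1"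
    and "(y3 - 1) ^ 2 * (1 - y5) * (y3 - y5) + \<eta> * y5 * (y4 - y3) * (y4 - y5) \<noteq> 0"
    and eqs: "f 1 + h 0 = 0" "h 1 = 0" "f y3 = 0" "h y3 + \<eta> * (f y4 + f y5) = 0" "f y5 = 0" "h y5 = 0"
  shows "f 1 = 0" "h y3 = 0"
proof -
  obtain c where c: "\<And>t. f t = c * (t - y3) * (t - y5)"
    using quadratic_two_roots[OF assms(1) eqs(3,5)] assms(3) by metis
  obtain e where e: "\<And>t. h t = e * (t - 1) * (t - y5)"
    using quadratic_two_roots[OF assms(2) eqs(2,6)] assms(5) by metis
  have e5: "e * y5 = - (c * (1 - y3) * (1 - y5))"
    using eqs(1) by (simp add: c e eq_neg_iff_add_eq_0 algebra_simps)
  have "0 = y5 * (h y3 + \<eta> * (f y4 + f y5))" using eqs(4) by simp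
  also have "\<dots> = (e * y5) * (y3 - 1) * (y3 - y5) + \<eta> * c * y5 * (y4 - y3) * (y4 - y5)"
    by (simp add: c e algebra_simps)
  also have "\<dots> = c * ((y3 - 1) ^ 2 * (1 - y5) * (y3 - y5) + \<eta> * y5 * (y4 - y3) * (y4 - y5))"
    unfolding e5 by (simp add: algebra_simps power2_eq_square)
  finally have "c = 0" using assms(6) by simp
  moreover from this have "e = 0" using e5 assms(4) by simp
  ultimately show "f 1 = 0" "h y3 = 0" by (simp_all add: c e)
qed

text \<open>Each of the last three expressions is affine in \<open>\<eta>\<close> and nonzero at 0,
  so it excludes at most one value. Five exclusions could still exhaust the field, and only
  inspection of the orderings of the points shows that they do not.\<close>

lemma exists_coefficient_card_5:
  fixes y3 y4 y5 :: "'a::{finite,field}"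
  assumes "card (UNIV :: 'a set) = 5" "distinct [0, 1, y3, y4, y5]"
  obtains \<eta> where "\<eta> \<noteq> 0" "\<eta> \<noteq> 1"
    "\<eta> * (y4 * (y4 - y3) + y5 * (y5 - y3)) - y4 * (y4 - y3) \<noteq> 0"
    "(1 - \<eta>) * (y3 - 1) ^ 2 * (y3 - y4) * (y4 - 1)
      + \<eta> * (y5 - y3) * (y4 * (y4 - y5) + (y3 - 1) ^ 2 * (y5 - 1)) \<noteq> 0"
    "(y3 - 1) ^ 2 * (1 - y5) * (y3 - y5) + \<eta> * y5 * (y4 - y3) * (y4 - y5) \<noteq> 0"
proof -
  note nz = of_int_card_5(1)[OF assms(1)]
  obtain w3 w4 w5 :: int where w: "y3 = of_int w3" "y4 = of_int w4" "y5 = of_int w5"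
    and range: "w3 \<in> {0,1,2,3,4}" "w4 \<in> {0,1,2,3,4}" "w5 \<in> {0,1,2,3,4}"
    using of_int_card_5(2)[OF assms(1)] by metis
  have neq: "w3 \<noteq> 0" "w3 \<noteq> 1" "w4 \<noteq> 0" "w4 \<noteq> 1" "w5 \<noteq> 0" "w5 \<noteq> 1" "w3 \<noteq> w4" "w3 \<noteq> w5" "w4 \<noteq> w5"
    using assms(2) unfolding w by (auto simp del: of_int_eq_iff)
  have "w3 \<in> {2,3,4}" "w4 \<in> {2,3,4}" "w5 \<in> {2,3,4}" using range neq(1-6) by simp_all
  then have cases: "(w3 = 2 \<and> w4 = 3 \<and> w5 = 4) \<or> (w3 = 2 \<and> w4 = 4 \<and> w5 = 3) \<or> (w3 = 3 \<and> w4 = 2 \<and> w5 = 4)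
      \<or> (w3 = 3 \<and> w4 = 4 \<and> w5 = 2) \<or> (w3 = 4 \<and> w4 = 2 \<and> w5 = 3) \<or> (w3 = 4 \<and> w4 = 3 \<and> w5 = 2)"
    using neq(7-9) by (elim insertE emptyE) simp_all
  \<comment> \<open>One admissible value for each of the six orderings, checked by arithmetic modulo
    5.\<close>
  define e :: int where "e = (if w3 = 4 then if w4 = 2 then 4 else 2 else w3)"
  have "\<not> 5 dvd e" "\<not> 5 dvd e - 1" "\<not> 5 dvd e * (w4 * (w4 - w3) + w5 * (w5 - w3)) - w4 * (w4 - w3)"
    "\<not> 5 dvd (1 - e) * (w3 - 1) ^ 2 * (w3 - w4) * (w4 - 1)
      + e * (w5 - w3) * (w4 * (w4 - w5) + (w3 - 1) ^ 2 * (w5 - 1))"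
    "\<not> 5 dvd (w3 - 1) ^ 2 * (1 - w5) * (w3 - w5) + e * w5 * (w4 - w3) * (w4 - w5)"
    using cases unfolding e_def by (elim disjE conjE; simp)+
  from this[folded nz] show thesis by (intro that[of "of_int e"]) (simp_all add: w)
qed

context st_code begin

text \<open>The critical coefficient is fixed while the other one, at \<open>(2, 1)\<close>, is
  still 0, which keeps the equations explicit. The remaining position has a single partner and is
  covered by the general count.\<close>

lemma good_start_card_5:
  assumes \<alpha>: "\<alpha> = 2" and k: "k = 3" and n: "n = 5" and q: "card (UNIV :: 'a set) = 5"
  obtains \<eta> where "\<eta> \<noteq> 0" "good ((\<lambda>_. 0)((2, 3) := \<eta>))"
proof -
  define y where "y j = (x j - x 1) / (x 2 - x 1)" for j
  have x: "x i \<noteq> x j" if "i \<noteq> j" "i \<in> {1..5}" "j \<in> {1..5}" for i j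
    using inj_x that n by (auto dest: inj_onD)
  have x21: "x 2 - x 1 \<noteq> 0" using x[of 2 1] by simp
  have y: "y i \<noteq> y j" if "i \<noteq> j" "i \<in> {1..5}" "j \<in> {1..5}" for i j
    using x[OF that] x21 by (simp add: y_def divide_cancel_right)
  have y1: "y 1 = 0" "y 2 = 1" using x21 by (simp_all add: y_def)
  have ydist: "distinct [0, 1, y 3, y 4, y 5]"
    using y[of 1 2] y[of 1 3] y[of 1 4] y[of 1 5] y[of 2 3] y[of 2 4] y[of 2 5] y[of 3 4] y[of 3 5] y[of 4 5] y1
    by simp
  obtain \<eta> where \<eta>: "\<eta> \<noteq> 0" "\<eta> \<noteq> 1"
    "\<eta> * (y 4 * (y 4 - y 3) + y 5 * (y 5 - y 3)) - y 4 * (y 4 - y 3) \<noteq> 0"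
    "(1 - \<eta>) * (y 3 - 1) ^ 2 * (y 3 - y 4) * (y 4 - 1)
      + \<eta> * (y 5 - y 3) * (y 4 * (y 4 - y 5) + (y 3 - 1) ^ 2 * (y 5 - 1)) \<noteq> 0"
    "(y 3 - 1) ^ 2 * (1 - y 5) * (y 3 - y 5) + \<eta> * y 5 * (y 4 - y 3) * (y 4 - y 5) \<noteq> 0"
    using exists_coefficient_card_5[OF q ydist] by metis
  let ?\<tau> = "(\<lambda>_. 0)((2, 3) := \<eta>)"
  have pos: "(2, 3) \<in> positions" using \<alpha> n unfolding positions_def by (simp add: st_columns_small)
  have act: "active 1" "active 2" "active 3" "active 4"
    unfolding active_def using \<alpha> n
    by ((intro bexI[of _ 2], simp_all add: st_columns_small)[1], (intro bexI[of _ 1], simp_all add: st_columns_small)[1],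
        (intro bexI[of _ 2], simp_all add: st_columns_small)[1], (intro bexI[of _ 1], simp_all add: st_columns_small)[1])
  have inact: "\<not> active 5"
  proof
    assume "active 5"
    then obtain i where i: "i \<in> {1..\<alpha>}" "i \<noteq> st_grp n \<alpha> 5" "st_cpl n \<alpha> i 5 \<noteq> {}"
      unfolding active_def by blast
    then have "i = 1" using \<alpha> n by (auto simp: st_columns_small)
    then show False using i(3) \<alpha> n by (simp add: st_columns_small)
  qed
  have dec0: "decodes (\<lambda>_. 0) S" if "S \<in> k_sets" for S using decodes_zero[OF that] .
  have generic: "decodes ?\<tau> S" if S: "S \<in> k_sets" "rows S = {1, 2}"
    and zero: "\<And>a f h. \<lbrakk>quadratic f; quadratic h; \<And>j. base_array x k a 1 j = f (y j);
      \<And>j. base_array x k a 2 j = h (y j); \<And>J. J \<in> S \<Longrightarrow> symbol ?\<tau> a 1 J = 0; \<And>J. J \<in> S \<Longrightarrow> symbol ?\<tau> a 2 J = 0\<rbrakk>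
      \<Longrightarrow> \<forall>J\<in>S. f (y J) = 0 \<and> h (y J) = 0" for S
    unfolding decodes_def
  proof (intro allI impI)
    fix a assume *: "\<forall>i\<in>rows S. \<forall>J\<in>S. symbol ?\<tau> a i J = 0"
    obtain f where f: "quadratic f" "\<And>j. base_array x k a 1 j = f (y j)"
      using rs_encode_quadratic[of x "a 1"] x[of 2 1] unfolding base_array_def k y_def by auto
    obtain h where h: "quadratic h" "\<And>j. base_array x k a 2 j = h (y j)"
      using rs_encode_quadratic[of x "a 2"] x[of 2 1] unfolding base_array_def k y_def by auto
    have 0: "\<forall>J\<in>S. f (y J) = 0 \<and> h (y J) = 0"
      using * S(2) by (intro zero[OF f(1) h(1) f(2) h(2)]) auto
    have "a 1 s = 0" "a 2 s = 0" if "s \<in> {1..k}" for s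
      using base_array_inj[OF S(1) _ that] 0 f(2) h(2) by simp_all
    then show "\<forall>i\<in>rows S. \<forall>s\<in>{1..k}. a i s = 0" using S(2) by simp
  qed
  have sym1: "symbol ?\<tau> a 1 1 = base_array x k a 1 1"
    "symbol ?\<tau> a 1 2 = base_array x k a 1 2 + base_array x k a 2 1"
    "symbol ?\<tau> a 1 3 = base_array x k a 1 3"
    "symbol ?\<tau> a 1 4 = base_array x k a 1 4 + base_array x k a 2 3"
    "symbol ?\<tau> a 1 5 = base_array x k a 1 5"
    "symbol ?\<tau> a 2 1 = base_array x k a 2 1"
    "symbol ?\<tau> a 2 2 = base_array x k a 2 2"
    "symbol ?\<tau> a 2 3 = base_array x k a 2 3 + \<eta> * (base_array x k a 1 4 + base_array x k a 1 5)"
    "symbol ?\<tau> a 2 4 = base_array x k a 2 4"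
    "symbol ?\<tau> a 2 5 = base_array x k a 2 5" for a
    unfolding symbol_def partner_def using \<alpha> n by (simp_all add: st_columns_small)
  have rows: "rows S = st_grp 5 2 ` (S - {5})" if "S \<subseteq> {1, 2, 3, 4, 5}" for S
  proof -
    have "{J \<in> S. active J} = S - {5}" using act inact that by auto
    then show ?thesis unfolding rows_def using \<alpha> n by simp
  qed
  have "decodes ?\<tau> S" if S: "S \<in> k_sets" for S
  proof -
    have S5: "S \<subseteq> {1, 2, 3, 4, 5}" "card S = 3" using S n k unfolding k_sets_def by auto
    show ?thesis
    proof (cases "3 \<in> S \<and> 2 \<in> rows S")
      case False
      then show ?thesis using decodes_upd_notin dec0[OF S] by blast
    next
      case True
      have "card (S - {3}) = 2" using True S5(2) by simp
      then obtain u v where uv: "S - {3} = {u, v}" "u \<noteq> v" by (meson card_2_iff)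
      then have "S = {3, u, v}" "u \<in> {1, 2, 4, 5}" "v \<in> {1, 2, 4, 5}" using True S5(1) by auto
      \<comment> \<open>All six triples through column 3. The first decodes through the pair of
        columns 1 and 2, the second contains both partners, and the third meets row 2 only in the
        inactive column 5. Only the last three restrict \<open>\<eta>\<close>.\<close>
      then consider "S = {1, 2, 3}" | "S = {3, 4, 5}" | "S = {1, 3, 5}"
        | "S = {1, 3, 4}" | "S = {2, 3, 4}" | "S = {2, 3, 5}"
        using uv(2) by (elim insertE emptyE; simp add: insert_commute)
      then show ?thesis
      proof cases
        case 1
        then show ?thesis using \<alpha> k n decodes_pair[of 3 ?\<tau>] by (simp add: st_columns_small)
      next
        case 2
        then show ?thesis
          using decodes_upd_partners[OF dec0[OF S] pos _ _ \<eta>(2)] \<alpha> n by (simp add: st_columns_small)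
      next
        case 3
        then have "rows S = {1}" using rows[OF S5(1)] by (simp add: st_columns_small insert_Diff_if)
        then show ?thesis using True by simp
      next
        case 4
        then have rS: "rows S = {1, 2}" using rows[OF S5(1)] by (auto simp: st_columns_small insert_Diff_if)
        show ?thesis
        proof (rule generic[OF S rS])
          fix a f h
          assume q: "quadratic f" "quadratic h" and b: "\<And>j. base_array x k a 1 j = f (y j)"
            "\<And>j. base_array x k a 2 j = h (y j)"
            and s: "\<And>J. J \<in> S \<Longrightarrow> symbol ?\<tau> a 1 J = 0" "\<And>J. J \<in> S \<Longrightarrow> symbol ?\<tau> a 2 J = 0"
          have eqs: "f 0 = 0" "h 0 = 0" "f (y 3) = 0" "h (y 3) + \<eta> * (f (y 4) + f (y 5)) = 0"
            "f (y 4) + h (y 3) = 0" "h (y 4) = 0"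
            using s(1)[of 1] s(2)[of 1] s(1)[of 3] s(2)[of 3] s(1)[of 4] s(2)[of 4] 4
            unfolding sym1 b y1 by simp_all
          show "\<forall>J\<in>S. f (y J) = 0 \<and> h (y J) = 0"
            using quadratics_vanish_134[OF q _ _ _ \<eta>(3) eqs] ydist eqs 4 y1 by auto
        qed
      next
        case 5
        then have rS: "rows S = {1, 2}" using rows[OF S5(1)] by (auto simp: st_columns_small insert_Diff_if)
        show ?thesis
        proof (rule generic[OF S rS])
          fix a f h
          assume q: "quadratic f" "quadratic h" and b: "\<And>j. base_array x k a 1 j = f (y j)"
            "\<And>j. base_array x k a 2 j = h (y j)"
            and s: "\<And>J. J \<in> S \<Longrightarrow> symbol ?\<tau> a 1 J = 0" "\<And>J. J \<in> S \<Longrightarrow> symbol ?\<tau> a 2 J = 0"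
          have eqs: "f 1 + h 0 = 0" "h 1 = 0" "f (y 3) = 0" "h (y 3) + \<eta> * (f (y 4) + f (y 5)) = 0"
            "f (y 4) + h (y 3) = 0" "h (y 4) = 0"
            using s(1)[of 2] s(2)[of 2] s(1)[of 3] s(2)[of 3] s(1)[of 4] s(2)[of 4] 5
            unfolding sym1 b y1 by simp_all
          show "\<forall>J\<in>S. f (y J) = 0 \<and> h (y J) = 0"
            using quadratics_vanish_234[OF q _ _ _ \<eta>(4) eqs] ydist eqs 5 y1 by auto
        qed
      next
        case 6
        then have rS: "rows S = {1, 2}" using rows[OF S5(1)] by (auto simp: st_columns_small insert_Diff_if)
        show ?thesis
        proof (rule generic[OF S rS])
          fix a f h
          assume q: "quadratic f" "quadratic h" and b: "\<And>j. base_array x k a 1 j = f (y j)"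
            "\<And>j. base_array x k a 2 j = h (y j)"
            and s: "\<And>J. J \<in> S \<Longrightarrow> symbol ?\<tau> a 1 J = 0" "\<And>J. J \<in> S \<Longrightarrow> symbol ?\<tau> a 2 J = 0"
          have eqs: "f 1 + h 0 = 0" "h 1 = 0" "f (y 3) = 0" "h (y 3) + \<eta> * (f (y 4) + f (y 5)) = 0"
            "f (y 5) = 0" "h (y 5) = 0"
            using s(1)[of 2] s(2)[of 2] s(1)[of 3] s(2)[of 3] s(1)[of 5] s(2)[of 5] 6
            unfolding sym1 b y1 by simp_all
          show "\<forall>J\<in>S. f (y J) = 0 \<and> h (y J) = 0"
            using quadratics_vanish_235[OF q _ _ _ \<eta>(5) eqs] ydist eqs 6 y1 by auto
        qed
      qed
    qed
  qed
  then have "good ?\<tau>" using \<eta>(2) by (simp add: good_def)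
  then show thesis using that \<eta>(1) by blast
qed

lemma exists_mds_coefficients:
  "\<exists>\<theta> :: nat \<Rightarrow> nat \<Rightarrow> nat \<Rightarrow> 'a. (\<forall>l i j. \<theta> l i j \<noteq> 0 \<and> \<theta> l i j \<noteq> 1) \<and>
    is_mds_array_code n k \<alpha> (st_rs n k \<alpha> x \<theta>)"
proof (cases "\<alpha> = 2 \<and> k = 3 \<and> n = 5 \<and> card (UNIV :: 'a set) = 5")
  case False
  then have "\<exists>\<sigma>. good \<sigma> \<and> (\<forall>p\<in>positions. \<sigma> p \<noteq> 0) \<and> (\<forall>p. p \<notin> positions \<longrightarrow> \<sigma> p = 0)"
    by (intro good_fill[OF finite_positions order.refl good_zero refl] safe_count) auto
  then show ?thesis using mds_if_good by blast
next
  case True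
  then obtain \<eta> where \<eta>: "\<eta> \<noteq> 0" "good ((\<lambda>_. 0)((2, 3) := \<eta>))" using good_start_card_5 by metis
  \<comment> \<open>Leaving \<open>(2, 3)\<close> out of the positions to be filled preserves the
    value \<open>\<eta>\<close> there.\<close>
  have "\<exists>\<sigma>. good \<sigma> \<and> (\<forall>p\<in>positions - {(2, 3)}. \<sigma> p \<noteq> 0) \<and>
      (\<forall>p. p \<notin> positions - {(2, 3)} \<longrightarrow> \<sigma> p = ((\<lambda>_. 0)((2, 3) := \<eta>)) p)"
    by (intro good_fill[OF _ _ \<eta>(2)] safe_count) (auto simp: finite_positions)
  then obtain \<sigma> where \<sigma>: "good \<sigma>" "\<forall>p\<in>positions - {(2, 3)}. \<sigma> p \<noteq> 0" "\<sigma> (2, 3) = \<eta>" by auto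
  then have "\<sigma> p \<noteq> 0" if "p \<in> positions" for p
    using \<eta>(1) that by (cases "p = (2, 3)") auto
  then show ?thesis using mds_if_good[OF \<sigma>(1)] by blast
qed

end

theorem theorem2:
  fixes n k \<alpha> :: nat
    and x :: "nat \<Rightarrow> 'a::{finite,field}"
  assumes "1 \<le> k" and "k < n"
    and "2 \<le> \<alpha>" and "\<alpha> \<le> n - k"
    and "\<exists>(p::nat) (e::nat). prime p \<and> 0 < e \<and> card (UNIV :: 'a set) = p ^ e"
    and "int (card (UNIV :: 'a set)) > int ((n - 1) choose (k - 1))
           - int ((nat \<lceil>real n / real \<alpha>\<rceil> - 1) choose (nat \<lceil>real k / real \<alpha>\<rceil> - 1))"
    and "inj_on x {1..n}"
  shows "\<exists>\<theta> :: nat \<Rightarrow> nat \<Rightarrow> nat \<Rightarrow> 'a.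
           (\<forall>l i j. \<theta> l i j \<noteq> 0 \<and> \<theta> l i j \<noteq> 1) \<and>
           is_mds_array_code n k \<alpha> (st_rs n k \<alpha> x \<theta>)"
proof -
  define N K where "N = nat \<lceil>real n / real \<alpha>\<rceil>" and "K = nat \<lceil>real k / real \<alpha>\<rceil>"
  interpret st_code n k \<alpha> x N K
  proof
    show "1 \<le> k" "2 \<le> \<alpha>" "k + \<alpha> \<le> n" "inj_on x {1..n}" using assms by auto
    show "\<alpha> * (N - 1) < n" "n \<le> \<alpha> * N"
      using ceiling_div_bounds[of \<alpha> n N] assms by (auto simp: N_def)
    show "\<alpha> * (K - 1) < k" "k \<le> \<alpha> * K" "1 \<le> K"
      using ceiling_div_bounds[of \<alpha> k K] assms by (auto simp: K_def)
    show "((n - 1) choose (k - 1)) < card (UNIV :: 'a set) + ((N - 1) choose (K - 1))"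
      using assms(6) unfolding N_def K_def by linarith
  qed
  show ?thesis by (rule exists_mds_coefficients)
qed

end
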